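(* Let $n\ge2$, $x\in S_{n-1}$, $F_x=\langle a^t\rangle$, $x^{-1}=a^{-x(s)}xa^s\in\mathcal{O}_x$ for some $s$, and $x(t)=jt$ with $j$ coprime to $\frac nt$. Let $\hat\chi$ be the character of the irreducible $J_n$-module induced from an irreducible representation of $F_x$. Then: (1) Permutations in the same orbit have the same indicators: if $y\in\mathcal{O}_x$ (so that $F_y=F_x$), then for any given irreducible representation $\rho$ of $F_x=F_y$, the characters $\hat\chi_x$ and $\hat\chi_y$ of the $J_n$-modules induced from $\rho$ via $x$ and via $y$ satisfy $\nu(\hat\chi_x)=\nu(\hat\chi_y)$. (This holds even if $x^{-1}\notin\mathcal{O}_x$.) (2) If $\mathcal{O}_x$ contains an element of order $2$, then $\nu(\hat\chi)\ge0$. (3) If $t$ is odd, then $\nu(\hat\chi)\ge0$. (4) If $n=2m$ with $m$ odd, then $\nu(\hat\chi)\ge0$.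
   Context: Identify $\{1,\dots,n\}$ with $\mathbb{Z}/n\mathbb{Z}$ (so $n=0$) and $S_n$ with the bijections of $\mathbb{Z}/n\mathbb{Z}$ under composition (right-to-left). $S_{n-1}$ is the subgroup of those $x$ with $x(n)=n$; $a=(1\,2\,\cdots\,n)$ is the shift $i\mapsto i+1$; $C_n=\langle a\rangle$. Values of permutations are computed modulo $n$. Each product $xa^r$ ($x\in S_{n-1}$) factors uniquely as $xa^r=(x\rhd a^r)(x\lhd a^r)$ with $x\rhd a^r\in C_n$, $x\lhd a^r\in S_{n-1}$; explicitly $x\rhd a^r=a^{x(r)}$ and $x\lhd a^r=a^{-x(r)}xa^r$. $\lhd$ is a right action of $C_n$ on the set $S_{n-1}$; $\mathcal{O}_x$ is the orbit and $F_x$ the stabilizer of $x$. Whenever we write $F_x=\langle a^t\rangle$, $t$ is the positive divisor of $n$ with this property. $J_n=\mathbb{C}^{S_{n-1}}\#\mathbb{C}C_n$ is the semisimple Hopf algebra with basis $p_y\#b$ ($y\in S_{n-1}$, $b\in C_n$), product $(p_y\#b)(p_z\#c)=\delta_{z,\,y\lhd b}\,p_y\#bc$, unit $\sum_y p_y\#1$, counit $\varepsilon(p_y\#b)=\delta_{y,1}$, coproduct $\Delta(p_y\#b)=\sum_{z}(p_{yz^{-1}}\#(z\rhd b))\otimes(p_z\#b)$, antipode $S(p_y\#b)=p_{(y\lhd b)^{-1}}\#(y\rhd b)^{-1}$. For an irreducible representation $V$ of $F_x$, the $J_n$-module induced via $x$ is $\hat V=\mathbb{C}C_n\otimes_{\mathbb{C}F_x}V$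 with $(p_y\#b)\cdot(c\otimes v)=\delta_{y\lhd(bc),x}\,(bc\otimes v)$. The Frobenius-Schur indicator of a $J_n$-module with character $\chi$ is $\nu(\chi)=\chi(\sum\Lambda_1\Lambda_2)$, where $\Lambda$ is the two-sided integral of $J_n$ with $\varepsilon(\Lambda)=1$ and $\Delta(\Lambda)=\sum\Lambda_1\otimes\Lambda_2$. *)

theory Defs
  imports
    "HOL-Combinatorics.Permutations"
    "HOL-Library.Complex_Order"
    "HOL-Number_Theory.Cong"
    "Jordan_Normal_Form.Matrix"
begin

section \<open>The factorization of the symmetric group\<close>

text \<open>
  The residues modulo \<open>n\<close> are represented by \<open>{..<n}\<close>, with \<open>n\<close> itself represented by \<open>0\<close>.
  So \<open>S\<^sub>n\<close> is the set of \<open>x\<close> with \<open>x permutes {..<n}\<close>, its product is \<open>\<circ>\<close>,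
  and the value of \<open>x\<close> at the residue class of \<open>r\<close> is \<open>x (r mod n)\<close>.
\<close>

type_synonym perm = "nat \<Rightarrow> nat"

definition Stab0 :: "nat \<Rightarrow> perm set"  \<comment> \<open>\<open>S\<^bsub>n-1\<^esub>\<close>\<close>
  where "Stab0 n = {x. x permutes {..<n} \<and> x 0 = 0}"

definition shift :: "nat \<Rightarrow> perm"  \<comment> \<open>the \<open>n\<close>-cycle \<open>a\<close>\<close>
  where "shift n = (\<lambda>i. if i < n then (i + 1) mod n else i)"

definition Cyc :: "nat \<Rightarrow> perm set"  \<comment> \<open>\<open>C\<^sub>n\<close>; natural exponents suffice as \<open>a\<close> has finite order\<close>
  where "Cyc n = {shift n ^^ r | r. True}"

text \<open>
  For \<open>b = a\<^sup>r\<close> the residue class of \<open>r\<close> is recovered as \<open>b 0\<close>, so the following are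
  \<open>x \<rhd> a\<^sup>r = a\<^bsup>x(r)\<^esup>\<close> and \<open>x \<lhd> a\<^sup>r = a\<^bsup>-x(r)\<^esup> x a\<^sup>r\<close>.
  See \<open>lact_shift_pow\<close>, \<open>ract_shift_pow\<close> and \<open>factorization_unique\<close> below.
\<close>

definition lact :: "nat \<Rightarrow> perm \<Rightarrow> perm \<Rightarrow> perm"  \<comment> \<open>\<open>x \<rhd> b\<close>\<close>
  where "lact n x b = shift n ^^ x (b 0)"

definition ract :: "nat \<Rightarrow> perm \<Rightarrow> perm \<Rightarrow> perm"  \<comment> \<open>\<open>x \<lhd> b\<close>\<close>
  where "ract n x b = Hilbert_Choice.inv (lact n x b) \<circ> x \<circ> b"

definition orb :: "nat \<Rightarrow> perm \<Rightarrow> perm set"  \<comment> \<open>\<open>\<O>\<^sub>x\<close>\<close>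
  where "orb n x = {ract n x b | b. b \<in> Cyc n}"

definition stab :: "nat \<Rightarrow> perm \<Rightarrow> perm set"  \<comment> \<open>\<open>F\<^sub>x\<close>\<close>
  where "stab n x = {b \<in> Cyc n. ract n x b = x}"

lemma shift_pow:
  assumes "i < n"
  shows "(shift n ^^ r) i = (i + r) mod n"
  using assms by (induction r) (auto simp: shift_def mod_Suc_eq)

lemma shift_pow_ge: "i \<ge> n \<Longrightarrow> (shift n ^^ r) i = i"
  by (induction r) (auto simp: shift_def)

lemma bij_shift: "bij (shift n)"
proof -
  have "inj_on (shift n) {..<n}"
    by (rule inj_onI) (auto simp: shift_def mod_Suc split: if_splits)
  moreover have "shift n ` {..<n} \<subseteq> {..<n}"
    by (auto simp: shift_def)
  ultimately have "bij_betw (shift n) {..<n} {..<n}"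
    by (simp add: bij_betw_def endo_inj_surj)
  then show ?thesis
    by (intro permutes_bij[of _ "{..<n}"] bij_imp_permutes) (auto simp: shift_def)
qed

lemma shift_pow_permutes: "(shift n ^^ r) permutes {..<n}"
  unfolding permutes_def
  using bij_fn[OF bij_shift, of r n] by (auto simp: shift_pow_ge bij_iff)

lemma lact_shift_pow: "n > 0 \<Longrightarrow> lact n x (shift n ^^ r) = shift n ^^ x (r mod n)"
  by (simp add: lact_def shift_pow)

lemma ract_shift_pow:
  "n > 0 \<Longrightarrow> ract n x (shift n ^^ r)
     = Hilbert_Choice.inv (shift n ^^ x (r mod n)) \<circ> x \<circ> (shift n ^^ r)"
  by (simp add: ract_def lact_shift_pow)

lemma lact_in_Cyc: "lact n x b \<in> Cyc n"
  by (auto simp: lact_def Cyc_def)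

lemma factorization: "x \<circ> b = lact n x b \<circ> ract n x b"
  using bij_fn[OF bij_shift[of n]]
  by (auto simp: ract_def lact_def fun_eq_iff bij_is_surj surj_f_inv_f)

lemma ract_in_Stab0:
  assumes "n > 0" "x \<in> Stab0 n" "b \<in> Cyc n"
  shows "ract n x b \<in> Stab0 n"
proof -
  from assms obtain r where b: "b = shift n ^^ r" by (auto simp: Cyc_def)
  have x: "x permutes {..<n}" using assms by (simp add: Stab0_def)
  have lt: "x (r mod n) < n"
    using permutes_in_image[OF x, of "r mod n"] assms by simp
  have "(shift n ^^ x (r mod n)) 0 = x (r mod n)"
    using lt assms by (simp add: shift_pow)
  then have "Hilbert_Choice.inv (shift n ^^ x (r mod n)) (x (r mod n)) = 0"
    using bij_fn[OF bij_shift[of n], THEN bij_is_inj] by (metis inv_f_f)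
  then have "ract n x b 0 = 0"
    using assms by (simp add: b ract_shift_pow shift_pow)
  moreover have "ract n x b permutes {..<n}"
    unfolding ract_def lact_def b
    by (intro permutes_compose permutes_inv x shift_pow_permutes)
  ultimately show ?thesis by (simp add: Stab0_def)
qed

lemma factorization_unique:
  assumes "n > 0" "x \<in> Stab0 n" "b \<in> Cyc n"
    and "c \<in> Cyc n" "z \<in> Stab0 n" "x \<circ> b = c \<circ> z"
  shows "c = lact n x b \<and> z = ract n x b"
proof -
  from assms obtain r where c: "c = shift n ^^ r" by (auto simp: Cyc_def)
  have "x (b 0) = c (z 0)" using assms by (simp add: fun_eq_iff)
  also have "\<dots> = r mod n" using assms by (simp add: c Stab0_def shift_pow)
  finally have "x (b 0) = r mod n" .
  then have "lact n x b i = c i" for i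
    by (cases "i < n") (simp_all add: lact_def c shift_pow shift_pow_ge mod_add_right_eq)
  then have l: "lact n x b = c" ..
  have "inj c" unfolding c using bij_fn[OF bij_shift] bij_is_inj by blast
  moreover have "c \<circ> z = c \<circ> ract n x b"
    using assms factorization[of x b n] l by simp
  ultimately show ?thesis using l by (auto simp: fun_eq_iff inj_eq)
qed


section \<open>The Hopf algebra \<open>J\<^sub>n\<close>\<close>

text \<open>
  An element of \<open>J\<^sub>n\<close> is its coefficient function with respect to the basis \<open>p\<^sub>y # b\<close>, indexed by
  the pairs \<open>(y, b)\<close>; an element of \<open>J\<^sub>n \<otimes> J\<^sub>n\<close> is its coefficient function with respect to
  the basis of pure tensors of basis elements. All functions vanish outside the index sets.
\<close>

type_synonym jelem = "perm \<times> perm \<Rightarrow> complex"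
type_synonym jtensor = "(perm \<times> perm) \<times> (perm \<times> perm) \<Rightarrow> complex"

definition Jidx :: "nat \<Rightarrow> (perm \<times> perm) set"
  where "Jidx n = Stab0 n \<times> Cyc n"

definition J :: "nat \<Rightarrow> jelem set"
  where "J n = {h. \<forall>k. k \<notin> Jidx n \<longrightarrow> h k = 0}"

definition basis_vec :: "'i \<Rightarrow> 'i \<Rightarrow> complex"
  where "basis_vec i = (\<lambda>k. if k = i then 1 else 0)"

definition jmul_basis :: "nat \<Rightarrow> perm \<times> perm \<Rightarrow> perm \<times> perm \<Rightarrow> jelem"
  where "jmul_basis n = (\<lambda>(y, b) (z, c).
    if z = ract n y b then basis_vec (y, b \<circ> c) else (\<lambda>_. 0))"

definition jmul :: "nat \<Rightarrow> jelem \<Rightarrow> jelem \<Rightarrow> jelem"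
  where "jmul n h k = (\<lambda>w. \<Sum>u\<in>Jidx n. \<Sum>v\<in>Jidx n. h u * k v * jmul_basis n u v w)"

definition junit :: "nat \<Rightarrow> jelem"
  where "junit n = (\<lambda>w. \<Sum>y\<in>Stab0 n. basis_vec (y, id) w)"

definition jcounit :: "nat \<Rightarrow> jelem \<Rightarrow> complex"
  where "jcounit n h = (\<Sum>(y, b)\<in>Jidx n. h (y, b) * (if y = id then 1 else 0))"

definition jcomul :: "nat \<Rightarrow> jelem \<Rightarrow> jtensor"
  where "jcomul n h = (\<lambda>w. \<Sum>(y, b)\<in>Jidx n. h (y, b) *
    (\<Sum>z\<in>Stab0 n. basis_vec ((y \<circ> Hilbert_Choice.inv z, lact n z b), (z, b)) w))"

definition jmul_tensor :: "nat \<Rightarrow> jtensor \<Rightarrow> jelem"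
    \<comment> \<open>the linear map \<open>h \<otimes> k \<mapsto> h k\<close> from \<open>J\<^sub>n \<otimes> J\<^sub>n\<close> to \<open>J\<^sub>n\<close>\<close>
  where "jmul_tensor n T = (\<lambda>w. \<Sum>(u, v)\<in>Jidx n \<times> Jidx n. T (u, v) * jmul_basis n u v w)"

definition two_sided_integral :: "nat \<Rightarrow> jelem \<Rightarrow> bool"
  where "two_sided_integral n L \<longleftrightarrow> L \<in> J n \<and>
    (\<forall>h\<in>J n. jmul n h L = (\<lambda>w. jcounit n h * L w) \<and>
             jmul n L h = (\<lambda>w. jcounit n h * L w))"

text \<open>
  At most one two-sided integral has counit 1, since
  \<open>L' = \<epsilon>(L) L' = L L' = \<epsilon>(L') L = L\<close>; it is \<open>1/n\<close> times the sum of all \<open>p\<^sub>1 # b\<close>.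
\<close>

definition jintegral :: "nat \<Rightarrow> jelem"
  where "jintegral n = (THE L. two_sided_integral n L \<and> jcounit n L = 1)"

definition fs_indicator :: "nat \<Rightarrow> (jelem \<Rightarrow> complex) \<Rightarrow> complex"
  where "fs_indicator n \<chi> = \<chi> (jmul_tensor n (jcomul n (jintegral n)))"


section \<open>Modules and characters\<close>

text \<open>
  Finite-dimensional modules are given as matrix representations. A representation of dimension
  \<open>N\<close> acts on the column vectors in \<^term>\<open>carrier_vec N\<close>.
\<close>

definition group_rep :: "perm set \<Rightarrow> nat \<Rightarrow> (perm \<Rightarrow> complex mat) \<Rightarrow> bool"
  where "group_rep F d \<rho> \<longleftrightarrow>
    (\<forall>f\<in>F. \<rho> f \<in> carrier_mat d d) \<and> \<rho> id = 1\<^sub>m d \<and>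
    (\<forall>f\<in>F. \<forall>g\<in>F. \<rho> (f \<circ> g) = \<rho> f * \<rho> g)"

definition invariant_subspace ::
    "perm set \<Rightarrow> nat \<Rightarrow> (perm \<Rightarrow> complex mat) \<Rightarrow> complex vec set \<Rightarrow> bool"
  where "invariant_subspace F d \<rho> W \<longleftrightarrow>
    W \<subseteq> carrier_vec d \<and> 0\<^sub>v d \<in> W \<and>
    (\<forall>v\<in>W. \<forall>w\<in>W. v + w \<in> W) \<and> (\<forall>k. \<forall>v\<in>W. k \<cdot>\<^sub>v v \<in> W) \<and>
    (\<forall>f\<in>F. \<forall>v\<in>W. \<rho> f *\<^sub>v v \<in> W)"

definition irreducible_rep :: "perm set \<Rightarrow> nat \<Rightarrow> (perm \<Rightarrow> complex mat) \<Rightarrow> bool"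
  where "irreducible_rep F d \<rho> \<longleftrightarrow> group_rep F d \<rho> \<and> d > 0 \<and>
    (\<forall>W. invariant_subspace F d \<rho> W \<longrightarrow> W = {0\<^sub>v d} \<or> W = carrier_vec d)"

definition J_rep :: "nat \<Rightarrow> nat \<Rightarrow> (jelem \<Rightarrow> complex mat) \<Rightarrow> bool"
  where "J_rep n N \<Phi> \<longleftrightarrow>
    (\<forall>h\<in>J n. \<Phi> h \<in> carrier_mat N N) \<and>
    (\<forall>h\<in>J n. \<forall>k\<in>J n. \<Phi> (\<lambda>w. h w + k w) = \<Phi> h + \<Phi> k) \<and>
    (\<forall>\<alpha>. \<forall>h\<in>J n. \<Phi> (\<lambda>w. \<alpha> * h w) = \<alpha> \<cdot>\<^sub>m \<Phi> h) \<and>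
    (\<forall>h\<in>J n. \<forall>k\<in>J n. \<Phi> (jmul n h k) = \<Phi> h * \<Phi> k) \<and>
    \<Phi> (junit n) = 1\<^sub>m N"

definition character :: "(jelem \<Rightarrow> complex mat) \<Rightarrow> jelem \<Rightarrow> complex"
  where "character \<Phi> h = (\<Sum>i<dim_row (\<Phi> h). \<Phi> h $$ (i, i))"

text \<open>
  A bilinear map on \<open>\<complex>C\<^sub>n \<times> V\<close> with \<open>V\<close> of dimension \<open>d\<close> amounts to a family of linear maps on
  \<open>V\<close> indexed by the basis \<open>C\<^sub>n\<close> of \<open>\<complex>C\<^sub>n\<close>. It is balanced over \<open>\<complex>F\<close> iff it is so on the
  basis \<open>F\<close> of \<open>\<complex>F\<close>.
\<close>

definition balanced_map ::
    "nat \<Rightarrow> perm set \<Rightarrow> nat \<Rightarrow> (perm \<Rightarrow> complex mat) \<Rightarrow> nat \<Rightarrow>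
      (perm \<Rightarrow> complex vec \<Rightarrow> complex vec) \<Rightarrow> bool"
  where "balanced_map n F d \<rho> M \<sigma> \<longleftrightarrow> (\<forall>c\<in>Cyc n.
    (\<forall>v\<in>carrier_vec d. \<sigma> c v \<in> carrier_vec M) \<and>
    (\<forall>v\<in>carrier_vec d. \<forall>w\<in>carrier_vec d. \<sigma> c (v + w) = \<sigma> c v + \<sigma> c w) \<and>
    (\<forall>k. \<forall>v\<in>carrier_vec d. \<sigma> c (k \<cdot>\<^sub>v v) = k \<cdot>\<^sub>v \<sigma> c v) \<and>
    (\<forall>f\<in>F. \<forall>v\<in>carrier_vec d. \<sigma> (c \<circ> f) v = \<sigma> c (\<rho> f *\<^sub>v v)))"

text \<open>
  The space \<open>\<complex>\<^sup>N\<close> together with \<open>\<tau> c v = c \<otimes> v\<close> is a tensor product \<open>\<complex>C\<^sub>n \<otimes>\<^bsub>\<complex>F\<^esub> V\<close>.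
  The universal property is only stated for finite-dimensional targets, which is enough as
  \<open>\<complex>C\<^sub>n \<times> V\<close> is finite-dimensional.
\<close>

definition tensor_product ::
    "nat \<Rightarrow> perm set \<Rightarrow> nat \<Rightarrow> (perm \<Rightarrow> complex mat) \<Rightarrow> nat \<Rightarrow>
      (perm \<Rightarrow> complex vec \<Rightarrow> complex vec) \<Rightarrow> bool"
  where "tensor_product n F d \<rho> N \<tau> \<longleftrightarrow> balanced_map n F d \<rho> N \<tau> \<and>
    (\<forall>M \<sigma>. balanced_map n F d \<rho> M \<sigma> \<longrightarrow>
      (\<exists>!L. L \<in> carrier_mat M N \<and> (\<forall>c\<in>Cyc n. \<forall>v\<in>carrier_vec d. L *\<^sub>v \<tau> c v = \<sigma> c v)))"

definition induced_rep ::
    "nat \<Rightarrow> perm \<Rightarrow> nat \<Rightarrow> (perm \<Rightarrow> complex mat) \<Rightarrow> nat \<Rightarrow> (jelem \<Rightarrow> complex mat) \<Rightarrow> bool"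
    \<comment> \<open>\<open>\<Phi>\<close> is, up to the choice of a basis, the \<open>J\<^sub>n\<close>-module induced via \<open>x\<close> from \<open>\<rho>\<close>\<close>
  where "induced_rep n x d \<rho> N \<Phi> \<longleftrightarrow> J_rep n N \<Phi> \<and>
    (\<exists>\<tau>. tensor_product n (stab n x) d \<rho> N \<tau> \<and>
      (\<forall>y\<in>Stab0 n. \<forall>b\<in>Cyc n. \<forall>c\<in>Cyc n. \<forall>v\<in>carrier_vec d.
        \<Phi> (basis_vec (y, b)) *\<^sub>v \<tau> c v =
          (if ract n y (b \<circ> c) = x then \<tau> (b \<circ> c) v else 0\<^sub>v N)))"

definition induced_character ::
    "nat \<Rightarrow> perm \<Rightarrow> nat \<Rightarrow> (perm \<Rightarrow> complex mat) \<Rightarrow> (jelem \<Rightarrow> complex) \<Rightarrow> bool"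
  where "induced_character n x d \<rho> \<chi> \<longleftrightarrow> (\<exists>N \<Phi>. induced_rep n x d \<rho> N \<Phi> \<and> \<chi> = character \<Phi>)"

end

theory Submission
  imports Defs "Jordan_Normal_Form.Spectral_Radius"
begin

text \<open>
  The integral is \<open>\<Lambda> = 1/n \<Sum>\<^sub>b p\<^sub>1 # b\<close>, and \<open>n \<Sum>\<Lambda>\<^sub>1\<Lambda>\<^sub>2\<close> is the sum of the
  \<open>p\<^bsub>z\<^sup>-\<^sup>1\<^esub> # (z \<rhd> b) b\<close> with \<open>z \<lhd> b = z\<^sup>-\<^sup>1\<close>.
  The induced character is \<open>tr \<rho>(b)\<close> on \<open>p\<^sub>y # b\<close> with \<open>y \<in> \<O>\<^sub>x\<close> and \<open>b \<in> F\<^sub>x\<close>, and \<open>0\<close> on the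
  other basis elements. So the indicator is a sum over the orbit, which gives (1).

  The generator \<open>a\<^sup>t\<close> of \<open>F\<^sub>x\<close> acts by a scalar \<open>\<omega>\<close> on the irreducible \<open>\<rho>\<close>. With \<open>e = x(s) + s\<close>,
  every element of the orbit contributes the same amount, and \<open>\<nu>\<close> vanishes unless \<open>t\<close> divides \<open>e\<close>
  and \<open>\<omega>\<^bsup>j+1\<^esup> = 1\<close>, in which case \<open>\<nu> = dim \<rho> \<cdot> \<omega>\<^bsup>-e/t\<^esup>\<close>. If inversion fixes some \<open>x \<lhd> a\<^sup>u\<close> in the orbit, then \<open>e/t\<close> is a multiple of
  \<open>j + 1\<close> modulo \<open>n/t\<close>, so \<open>\<nu> \<ge> 0\<close>; this covers (2), and also odd \<open>t\<close>, because inversion is an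
  involution of the \<open>t\<close> elements of the orbit. Finally \<open>x(e) = e\<close> yields \<open>\<omega>\<^bsup>2e/t\<^esup> = 1\<close>, so
  \<open>\<nu> \<ge> 0\<close> when \<open>n/t\<close> is odd, which together with the case of odd \<open>t\<close> covers (4).
\<close>

text \<open>The power \<open>a^i\<close> with an integer exponent, so that inverses and differences
  of exponents can be written directly.\<close>

definition shift_int :: "nat \<Rightarrow> int \<Rightarrow> perm"
  where "shift_int n i = shift n ^^ nat (i mod int n)"

text \<open>\<open>x\<close> read as an \<open>n\<close>-periodic function on the integers.
  Equations between permutations thus become congruences modulo \<open>n\<close>.\<close>

definition perm_int :: "nat \<Rightarrow> perm \<Rightarrow> int \<Rightarrow> int"
  where "perm_int n x i = int (x (nat (i mod int n)))"

section \<open>Matrices, linear maps and two general facts on cyclic groups and involutions\<close>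

lemma Ex1_unique: "\<exists>!x. P x \<Longrightarrow> P a \<Longrightarrow> P b \<Longrightarrow> a = b"
  by blast

lemma mult_mat_vec_index:
  assumes "A \<in> carrier_mat r c" "w \<in> carrier_vec c" "p < r"
  shows "(A *\<^sub>v w) $ p = (\<Sum>q<c. A $$ (p, q) * w $ q)"
  using assms by (simp add: scalar_prod_def lessThan_atLeast0)

lemma mult_mat_index:
  assumes "A \<in> carrier_mat r m" "B \<in> carrier_mat m c" "i < r" "j < c"
  shows "(A * B) $$ (i, j) = (\<Sum>q<m. A $$ (i, q) * B $$ (q, j))"
  using assms by (simp add: scalar_prod_def lessThan_atLeast0)

text \<open>Both sides are the same double sum. The rectangular form later moves a trace from the
  induced module to \<open>V\<close>.\<close>

lemma sum_diag_mult_commute: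
  fixes A B :: "complex mat"
  assumes "A \<in> carrier_mat N d" "B \<in> carrier_mat d N"
  shows "(\<Sum>i<N. (A * B) $$ (i, i)) = (\<Sum>l<d. (B * A) $$ (l, l))"
proof -
  have "(\<Sum>i<N. (A * B) $$ (i, i)) = (\<Sum>i<N. \<Sum>l<d. A $$ (i, l) * B $$ (l, i))"
    using assms by (simp add: mult_mat_index del: index_mult_mat)
  also have "\<dots> = (\<Sum>l<d. \<Sum>i<N. B $$ (l, i) * A $$ (i, l))"
    by (subst sum.swap) (simp add: mult.commute)
  also have "\<dots> = (\<Sum>l<d. (B * A) $$ (l, l))"
    using assms by (simp add: mult_mat_index del: index_mult_mat)
  finally show ?thesis .
qed

text \<open>The columns are the images of the unit vectors. The lemma is meant for the maps sending
  \<open>v\<close> to \<open>c \<otimes> v\<close>.\<close>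

lemma linear_map_matrix:
  fixes f :: "complex vec \<Rightarrow> complex vec"
  assumes car: "\<And>v. v \<in> carrier_vec d \<Longrightarrow> f v \<in> carrier_vec N"
    and add: "\<And>v w. v \<in> carrier_vec d \<Longrightarrow> w \<in> carrier_vec d \<Longrightarrow> f (v + w) = f v + f w"
    and smult: "\<And>k v. v \<in> carrier_vec d \<Longrightarrow> f (k \<cdot>\<^sub>v v) = k \<cdot>\<^sub>v f v"
  obtains M where "M \<in> carrier_mat N d" "\<And>v. v \<in> carrier_vec d \<Longrightarrow> f v = M *\<^sub>v v"
proof
  define M where "M = mat N d (\<lambda>(p, l). f (unit_vec d l) $ p)"
  show M: "M \<in> carrier_mat N d" by (simp add: M_def)
  fix v :: "complex vec" assume v: "v \<in> carrier_vec d"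
  \<comment> \<open>\<open>trunc k\<close> keeps the first \<open>k\<close> coordinates of
    \<open>v\<close>, so that \<open>f v\<close> is built up one coordinate at a time.\<close>
  define trunc where "trunc k = vec d (\<lambda>i. if i < k then v $ i else 0)" for k
  have trunc_car: "trunc k \<in> carrier_vec d" for k by (simp add: trunc_def)
  have step: "trunc (Suc k) = trunc k + v $ k \<cdot>\<^sub>v unit_vec d k" if "k < d" for k
    using that by (intro eq_vecI) (auto simp: trunc_def less_Suc_eq)
  have "f (trunc k) $ p = (\<Sum>l<k. v $ l * f (unit_vec d l) $ p)" if "p < N" "k \<le> d" for p k
    using that
  proof (induction k)
    case 0
    \<comment> \<open>\<open>f\<close> sends the zero vector to zero by homogeneity with the scalar
      0.\<close>
    have "0 \<cdot>\<^sub>v trunc 0 = trunc 0" by (intro eq_vecI) (auto simp: trunc_def)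
    then have "f (trunc 0) = 0 \<cdot>\<^sub>v f (trunc 0)" using smult[OF trunc_car, of 0 0] by simp
    moreover have "f (trunc 0) \<in> carrier_vec N" by (rule car[OF trunc_car])
    ultimately show ?case
      using 0 by (metis carrier_vecD index_smult_vec(1) lessThan_0 mult_zero_left sum.empty)
  next
    case (Suc k)
    have "f (trunc (Suc k)) = f (trunc k) + v $ k \<cdot>\<^sub>v f (unit_vec d k)"
      using Suc by (simp add: step add trunc_car smult)
    with Suc car[OF trunc_car, of k] car[of "unit_vec d k"] show ?case by simp
  qed
  moreover have "trunc d = v" using v by (intro eq_vecI) (auto simp: trunc_def)
  ultimately have "f v $ p = (\<Sum>l<d. v $ l * f (unit_vec d l) $ p)" if "p < N" for p
    using that by auto
  with v M car[OF v] show "f v = M *\<^sub>v v"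
    by (intro eq_vecI) (auto simp: M_def scalar_prod_def lessThan_atLeast0 mult.commute)
qed

text \<open>Schur's lemma for a cyclic group: an eigenspace of the generator is nonzero, and it is
  invariant because \<open>F\<close> is commutative, so by irreducibility it is the whole
  space.\<close>

lemma irreducible_rep_cyclic_scalar:
  assumes irr: "irreducible_rep F d \<rho>" and F: "F = {g ^^ k | k. True}"
  obtains \<omega> where "\<And>k. \<rho> (g ^^ k) = \<omega> ^ k \<cdot>\<^sub>m 1\<^sub>m d"
proof -
  have gF: "g ^^ k \<in> F" for k unfolding F by blast
  then have g: "g \<in> F" using gF[of 1] by simp
  have d: "d > 0" and car: "\<And>f. f \<in> F \<Longrightarrow> \<rho> f \<in> carrier_mat d d" and \<rho>_id: "\<rho> id = 1\<^sub>m d"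
    and mult: "\<And>f h. f \<in> F \<Longrightarrow> h \<in> F \<Longrightarrow> \<rho> (f \<circ> h) = \<rho> f * \<rho> h"
    using irr unfolding irreducible_rep_def group_rep_def by blast+
  obtain \<omega> v where v: "v \<in> carrier_vec d" "v \<noteq> 0\<^sub>v d" "\<rho> g *\<^sub>v v = \<omega> \<cdot>\<^sub>v v"
    using spectrum_non_empty[OF car[OF g] d] car[OF g]
    by (auto simp: spectrum_def eigenvalue_def eigenvector_def)
  define W where "W = {w \<in> carrier_vec d. \<rho> g *\<^sub>v w = \<omega> \<cdot>\<^sub>v w}"
  have "invariant_subspace F d \<rho> W"
    unfolding invariant_subspace_def
  proof (intro conjI ballI allI)
    fix f w assume f: "f \<in> F" and w: "w \<in> W"
    then obtain k where k: "f = g ^^ k" unfolding F by blast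
    have wd: "w \<in> carrier_vec d" using w by (simp add: W_def)
    have "g \<circ> f = f \<circ> g" unfolding k by (metis funpow.simps(2) funpow_Suc_right)
    then have comm: "\<rho> g * \<rho> f = \<rho> f * \<rho> g" using mult f g by metis
    have "\<rho> g *\<^sub>v (\<rho> f *\<^sub>v w) = (\<rho> g * \<rho> f) *\<^sub>v w"
      using car[OF f] car[OF g] wd by simp
    also have "\<dots> = \<rho> f *\<^sub>v (\<omega> \<cdot>\<^sub>v w)"
      unfolding comm using car[OF f] car[OF g] wd w by (simp add: W_def)
    also have "\<dots> = \<omega> \<cdot>\<^sub>v (\<rho> f *\<^sub>v w)"
      by (rule mult_mat_vec[OF car[OF f] wd])
    finally show "\<rho> f *\<^sub>v w \<in> W" using car[OF f] wd by (simp add: W_def)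
  next
    show "0\<^sub>v d \<in> W" using car[OF g] by (auto simp: W_def intro!: eq_vecI)
  next
    fix v w assume "v \<in> W" "w \<in> W"
    then show "v + w \<in> W"
      using car[OF g] by (auto simp: W_def mult_add_distrib_mat_vec[of _ d d] smult_add_distrib_vec[of _ d])
  next
    fix k v assume "v \<in> W"
    then show "k \<cdot>\<^sub>v v \<in> W"
      using car[OF g] by (auto simp: W_def mult_mat_vec[of _ d d] smult_smult_assoc mult.commute)
  qed (simp add: W_def)
  moreover have "v \<in> W" using v by (simp add: W_def)
  ultimately have W: "W = carrier_vec d"
    using irr v(2) unfolding irreducible_rep_def by blast
  have \<rho>g: "\<rho> g = \<omega> \<cdot>\<^sub>m 1\<^sub>m d"
  proof (rule eq_matI)
    fix i l assume "i < dim_row (\<omega> \<cdot>\<^sub>m 1\<^sub>m d)" "l < dim_col (\<omega> \<cdot>\<^sub>m 1\<^sub>m d)"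
    then have il: "i < d" "l < d" by simp_all
    have "unit_vec d l \<in> W" by (simp add: W)
    then have "(\<rho> g *\<^sub>v unit_vec d l) $ i = (\<omega> \<cdot>\<^sub>v unit_vec d l) $ i" by (simp add: W_def)
    then show "\<rho> g $$ (i, l) = (\<omega> \<cdot>\<^sub>m 1\<^sub>m d) $$ (i, l)"
      using il car[OF g] by (simp add: scalar_prod_right_unit)
  qed (use car[OF g] in auto)
  have "\<rho> (g ^^ k) = \<omega> ^ k \<cdot>\<^sub>m 1\<^sub>m d" for k
  proof (induction k)
    case 0
    have "1 \<cdot>\<^sub>m 1\<^sub>m d = (1\<^sub>m d :: complex mat)" by (intro eq_matI) auto
    then show ?case using \<rho>_id by (simp add: id_def)
  next
    case (Suc k)
    then have "\<rho> (g ^^ Suc k) = (\<omega> \<cdot>\<^sub>m 1\<^sub>m d) * (\<omega> ^ k \<cdot>\<^sub>m 1\<^sub>m d)"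
      using mult[OF g gF[of k]] \<rho>g by simp
    also have "\<dots> = \<omega> ^ Suc k \<cdot>\<^sub>m 1\<^sub>m d"
      by (intro eq_matI) (auto simp: mult_smult_distrib[of _ d d] mult_smult_assoc_mat[of _ d d])
    finally show ?case .
  qed
  then show thesis by (rule that)
qed

text \<open>Removing a pair \<open>{a, f a}\<close> with distinct members keeps the cardinality odd,
  so the induction must meet a fixed point.\<close>

lemma involution_fixpoint:
  assumes "finite A" "odd (card A)" "f ` A \<subseteq> A" "\<And>a. a \<in> A \<Longrightarrow> f (f a) = a"
  shows "\<exists>a\<in>A. f a = a"
  using assms
proof (induction "card A" arbitrary: A rule: less_induct)
  case less
  then obtain a where a: "a \<in> A" by fastforce
  show ?case
  proof (cases "f a = a")
    case False
    let ?B = "A - {a, f a}"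
    have fa: "f a \<in> A" using less a by auto
    have card: "card ?B = card A - 2"
      using less(2) a fa False by (simp add: card_Diff_subset)
    moreover have "card {a, f a} \<le> card A" using less(2) a fa by (intro card_mono) auto
    ultimately have "card ?B < card A" "odd (card ?B)" using less(3) False by auto
    moreover have "f ` ?B \<subseteq> ?B"
    proof
      fix b assume "b \<in> f ` ?B"
      then obtain c where c: "c \<in> A" "c \<noteq> a" "c \<noteq> f a" "b = f c" by auto
      with less(4,5) a show "b \<in> ?B" by (metis DiffI image_subset_iff insertE singletonD)
    qed
    ultimately have "\<exists>b\<in>?B. f b = b" using less(1)[of ?B] less(2,5) by auto
    then show ?thesis by auto
  qed (use a in auto)
qed

section \<open>Integer exponents in the cyclic group\<close>

context
  fixes n :: nat
  assumes n: "n > 0"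
begin

lemma shift_int_apply: "k < n \<Longrightarrow> shift_int n i k = nat ((int k + i) mod int n)"
proof -
  assume "k < n"
  have "int ((k + nat (i mod int n)) mod n) = (int k + i) mod int n"
    using n by (simp add: zmod_int mod_simps)
  with \<open>k < n\<close> show ?thesis by (simp add: shift_int_def shift_pow)
qed

lemma shift_int_apply_ge: "k \<ge> n \<Longrightarrow> shift_int n i k = k"
  by (simp add: shift_int_def shift_pow_ge)

lemma shift_int_add: "shift_int n i \<circ> shift_int n j = shift_int n (i + j)"
proof
  fix k
  show "(shift_int n i \<circ> shift_int n j) k = shift_int n (i + j) k"
  proof (cases "k < n")
    case True
    define l where "l = shift_int n j k"
    have "l < n" "int l = (int k + j) mod int n"
      using n True by (simp_all add: l_def shift_int_apply nat_less_iff)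
    then have "shift_int n i l = nat ((int k + (i + j)) mod int n)"
      by (simp add: shift_int_apply mod_add_left_eq add.assoc add.commute[of i])
    then show ?thesis using True by (simp add: shift_int_apply l_def)
  qed (simp add: shift_int_apply_ge)
qed

lemma shift_int_0: "shift_int n 0 = id"
  by (simp add: shift_int_def id_def)

lemma shift_int_cong: "[i = j] (mod int n) \<Longrightarrow> shift_int n i = shift_int n j"
  by (simp add: shift_int_def cong_def)

lemma shift_int_at_0: "int (shift_int n i 0) = i mod int n"
  using n by (simp add: shift_int_apply)

lemma shift_int_eq_iff: "shift_int n i = shift_int n j \<longleftrightarrow> [i = j] (mod int n)"
proof
  assume "shift_int n i = shift_int n j"
  then show "[i = j] (mod int n)"
    using shift_int_at_0[of i] shift_int_at_0[of j] by (simp add: cong_def)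
qed (rule shift_int_cong)

lemma shift_pow_eq: "shift n ^^ r = shift_int n (int r)"
proof
  fix k
  have "nat ((int k + int r) mod int n) = (k + r) mod n"
    unfolding of_nat_add[symmetric] zmod_int[symmetric] by simp
  then show "(shift n ^^ r) k = shift_int n (int r) k"
    by (cases "k < n") (simp_all add: shift_pow shift_int_apply shift_int_apply_ge shift_pow_ge)
qed

lemma Cyc_eq: "Cyc n = range (shift_int n)"
proof
  show "Cyc n \<subseteq> range (shift_int n)" by (auto simp: Cyc_def shift_pow_eq)
  show "range (shift_int n) \<subseteq> Cyc n" by (auto simp: Cyc_def shift_int_def)
qed

lemma Cyc_eq_image: "Cyc n = shift_int n ` {0..<int n}"
proof -
  have "shift_int n i \<in> shift_int n ` {0..<int n}" for i
    using n by (intro image_eqI[of _ _ "i mod int n"]) (auto simp: shift_int_eq_iff)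
  then show ?thesis by (auto simp: Cyc_eq)
qed

lemma finite_Cyc: "finite (Cyc n)"
  by (simp add: Cyc_eq_image)

lemma card_Cyc: "card (Cyc n) = n"
proof -
  have "inj_on (shift_int n) {0..<int n}"
    by (rule inj_onI) (auto simp: shift_int_eq_iff cong_def)
  then show ?thesis by (simp add: Cyc_eq_image card_image)
qed

lemma id_in_Cyc: "id \<in> Cyc n"
  unfolding Cyc_eq by (metis rangeI shift_int_0)

lemma comp_in_Cyc: "b \<in> Cyc n \<Longrightarrow> c \<in> Cyc n \<Longrightarrow> b \<circ> c \<in> Cyc n"
  by (auto simp: Cyc_eq shift_int_add)

lemma Cyc_commute: "b \<in> Cyc n \<Longrightarrow> c \<in> Cyc n \<Longrightarrow> b \<circ> c = c \<circ> b"
  by (auto simp: Cyc_eq shift_int_add add.commute)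

lemma inv_shift_int: "Hilbert_Choice.inv (shift_int n i) = shift_int n (- i)"
  by (intro inv_unique_comp) (simp_all add: shift_int_add shift_int_0)

lemma inv_in_Cyc: "b \<in> Cyc n \<Longrightarrow> Hilbert_Choice.inv b \<in> Cyc n"
  by (auto simp: Cyc_eq inv_shift_int)

lemma Cyc_inv:
  assumes "b \<in> Cyc n"
  shows "b \<circ> Hilbert_Choice.inv b = id" "Hilbert_Choice.inv b \<circ> b = id"
    "Hilbert_Choice.inv (Hilbert_Choice.inv b) = b"
  using assms by (auto simp: Cyc_eq inv_shift_int shift_int_add shift_int_0)

lemma bij_betw_Cyc_comp:
  assumes "b \<in> Cyc n"
  shows "bij_betw (\<lambda>c. b \<circ> c) (Cyc n) (Cyc n)"
proof (rule bij_betwI[where g = "\<lambda>c. Hilbert_Choice.inv b \<circ> c"])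
  show "Hilbert_Choice.inv b \<circ> (b \<circ> c) = c" for c
    by (simp add: Cyc_inv[OF assms] flip: comp_assoc)
  show "b \<circ> (Hilbert_Choice.inv b \<circ> c) = c" for c
    by (simp add: Cyc_inv[OF assms] flip: comp_assoc)
qed (use assms in \<open>auto intro!: comp_in_Cyc inv_in_Cyc\<close>)

lemma bij_betw_Cyc_inv: "bij_betw Hilbert_Choice.inv (Cyc n) (Cyc n)"
  by (rule bij_betwI[where g = Hilbert_Choice.inv]) (auto simp: Cyc_inv inv_in_Cyc)

section \<open>The group \<open>Stab0 n\<close> and the action of the cyclic group on it\<close>

lemma finite_Stab0: "finite (Stab0 n)"
  unfolding Stab0_def by (rule finite_subset[OF _ finite_permutations[of "{..<n}"]]) auto

lemma inv_in_Stab0: "x \<in> Stab0 n \<Longrightarrow> Hilbert_Choice.inv x \<in> Stab0 n"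
  unfolding Stab0_def by (auto simp: permutes_inv permutes_inv_eq)

lemma inv_inv_Stab0: "x \<in> Stab0 n \<Longrightarrow> Hilbert_Choice.inv (Hilbert_Choice.inv x) = x"
  unfolding Stab0_def by (auto simp: permutes_inv_inv)

lemma id_in_Stab0: "id \<in> Stab0 n"
  by (auto simp: Stab0_def permutes_id)

lemma perm_int_0: "x \<in> Stab0 n \<Longrightarrow> perm_int n x 0 = 0"
  by (simp add: perm_int_def Stab0_def)

lemma perm_int_range: "x \<in> Stab0 n \<Longrightarrow> perm_int n x i mod int n = perm_int n x i"
proof -
  assume "x \<in> Stab0 n"
  then have "x permutes {..<n}" by (simp add: Stab0_def)
  from permutes_in_image[OF this, of "nat (i mod int n)"] n
  show ?thesis by (simp add: perm_int_def nat_less_iff)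
qed

text \<open>Values of \<open>perm_int\<close> are already reduced, so congruence means equality;
  from \<open>n\<close> on both permutations are the identity.\<close>

lemma Stab0_eqI:
  assumes "x \<in> Stab0 n" "y \<in> Stab0 n" "\<And>i. [perm_int n x i = perm_int n y i] (mod int n)"
  shows "x = y"
proof
  fix k
  show "x k = y k"
  proof (cases "k < n")
    case True
    have "perm_int n x (int k) = perm_int n y (int k)"
      using assms(3)[of "int k"] by (simp add: cong_def perm_int_range assms)
    with True show ?thesis by (simp add: perm_int_def)
  next
    case False
    then show ?thesis using assms(1,2) by (auto simp: Stab0_def permutes_def)
  qed
qed

lemma perm_int_inv:
  assumes "x \<in> Stab0 n"
  shows "[perm_int n (Hilbert_Choice.inv x) (perm_int n x i) = i] (mod int n)"
proof -
  have "x permutes {..<n}" using assms by (simp add: Stab0_def)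
  moreover have "nat (perm_int n x i mod int n) = x (nat (i mod int n))"
    by (simp add: perm_int_range[OF assms]) (simp add: perm_int_def)
  ultimately show ?thesis
    using n by (simp add: perm_int_def[of n "Hilbert_Choice.inv x"] permutes_inverses cong_def)
qed

lemma lact_shift_int: "lact n x (shift_int n i) = shift_int n (perm_int n x i)"
  using n by (simp add: lact_def perm_int_def shift_pow_eq shift_int_apply)

text \<open>This is \<open>a^(-x(r)) x a^r\<close> evaluated at \<open>i\<close>. Later calculations
  with values of \<open>ract\<close> rest on it.\<close>

lemma perm_int_ract:
  assumes "x \<in> Stab0 n"
  shows "[perm_int n (ract n x (shift_int n r)) i = perm_int n x (i + r) - perm_int n x r] (mod int n)"
proof -
  let ?k = "nat (i mod int n)" and ?l = "nat ((i + r) mod int n)"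
  have "x permutes {..<n}" using assms by (simp add: Stab0_def)
  then have lt: "x ?l < n"
    using permutes_in_image[of x "{..<n}" ?l] n by (simp add: nat_less_iff)
  have k: "?k < n" using n by (simp add: nat_less_iff)
  have "shift_int n r ?k = ?l"
    using n by (simp add: shift_int_apply[OF k] mod_simps)
  then have "ract n x (shift_int n r) ?k = nat ((int (x ?l) - perm_int n x r) mod int n)"
    by (simp add: ract_def lact_shift_int inv_shift_int shift_int_apply[OF lt])
  then show ?thesis
    using n by (simp add: perm_int_def[of _ _ i] perm_int_def[of _ x "i + r"])
qed

lemma ract_in: "x \<in> Stab0 n \<Longrightarrow> b \<in> Cyc n \<Longrightarrow> ract n x b \<in> Stab0 n"
  using ract_in_Stab0[OF n] .

text \<open>The law of a right action. In terms of values, the two subtracted copies of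
  \<open>x(i)\<close> cancel.\<close>

lemma ract_ract:
  assumes "x \<in> Stab0 n" "b \<in> Cyc n" "c \<in> Cyc n"
  shows "ract n (ract n x b) c = ract n x (b \<circ> c)"
proof -
  from assms obtain i j where bc: "b = shift_int n i" "c = shift_int n j" by (auto simp: Cyc_eq)
  show ?thesis
  proof (rule Stab0_eqI)
    fix k
    note A = perm_int_ract[OF ract_in[OF assms(1,2)], of j k, unfolded bc]
    note B = perm_int_ract[OF assms(1)]
    have eq: "(perm_int n x (k + j + i) - perm_int n x i) - (perm_int n x (j + i) - perm_int n x i)
      = perm_int n x (k + (i + j)) - perm_int n x (i + j)"
      by (simp add: algebra_simps)
    have "[perm_int n (ract n (ract n x b) c) k
      = (perm_int n x (k + j + i) - perm_int n x i) - (perm_int n x (j + i) - perm_int n x i)] (mod int n)"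
      unfolding bc by (rule cong_trans[OF A]) (intro cong_diff B)
    then show "[perm_int n (ract n (ract n x b) c) k = perm_int n (ract n x (b \<circ> c)) k] (mod int n)"
      unfolding eq unfolding bc shift_int_add by (rule cong_trans) (rule cong_sym[OF B])
  qed (use assms in \<open>auto intro!: ract_in comp_in_Cyc\<close>)
qed

lemma ract_id: "x \<in> Stab0 n \<Longrightarrow> ract n x id = x"
  using n by (simp add: ract_def lact_def Stab0_def)

lemma ract_eq_iff:
  assumes "x \<in> Stab0 n" "y \<in> Stab0 n" "b \<in> Cyc n"
  shows "ract n y b = x \<longleftrightarrow> y = ract n x (Hilbert_Choice.inv b)"
proof
  assume "ract n y b = x"
  then have "ract n x (Hilbert_Choice.inv b) = ract n y (b \<circ> Hilbert_Choice.inv b)"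
    using assms by (auto simp: ract_ract inv_in_Cyc)
  then show "y = ract n x (Hilbert_Choice.inv b)"
    using assms by (simp add: Cyc_inv ract_id)
next
  assume "y = ract n x (Hilbert_Choice.inv b)"
  then show "ract n y b = x"
    using assms by (simp add: Cyc_inv ract_id ract_ract inv_in_Cyc)
qed

text \<open>Acting with \<open>b\<close> commutes with acting with \<open>c\<close>, since the group
  is commutative, and acting with \<open>c\<close> is injective.\<close>

lemma stab_ract:
  assumes "x \<in> Stab0 n" "c \<in> Cyc n"
  shows "stab n (ract n x c) = stab n x"
proof -
  have "ract n (ract n x c) b = ract n x c \<longleftrightarrow> ract n x b = x" if b: "b \<in> Cyc n" for b
  proof -
    have "ract n (ract n x c) b = ract n (ract n x b) c"
      using assms b by (simp add: ract_ract Cyc_commute)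
    then show ?thesis using assms b
      by (metis ract_eq_iff ract_in)
  qed
  then show ?thesis by (auto simp: stab_def)
qed

lemma ract_id_left:
  assumes "b \<in> Cyc n" shows "ract n id b = id"
proof -
  from assms obtain i where b: "b = shift_int n i" by (auto simp: Cyc_eq)
  have *: "perm_int n id k = k mod int n" for k
    using n by (simp add: perm_int_def)
  show ?thesis
  proof (rule Stab0_eqI)
    fix k
    show "[perm_int n (ract n id b) k = perm_int n id k] (mod int n)"
      using perm_int_ract[OF id_in_Stab0, of i k] by (simp add: b * cong_def mod_simps)
  qed (use assms in \<open>auto intro: ract_in id_in_Stab0\<close>)
qed

text \<open>Inverting \<open>z b = (z \<rhd> b) (z \<lhd> b)\<close> gives the factorization of \<open>z\<^sup>-\<^sup>1 (z \<rhd> b)\<close>.\<close>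

lemma ract_inv_lact:
  assumes z: "z \<in> Stab0 n" and b: "b \<in> Cyc n"
  shows "ract n (Hilbert_Choice.inv z) (lact n z b) = Hilbert_Choice.inv (ract n z b)"
proof -
  let ?w = "ract n z b"
  have w: "?w \<in> Stab0 n" using assms by (rule ract_in)
  have "Hilbert_Choice.inv z \<circ> lact n z b \<circ> ?w = Hilbert_Choice.inv z \<circ> (z \<circ> b)"
    by (simp add: factorization[of z b n] comp_assoc)
  also have "\<dots> = b"
    using z by (auto simp: Stab0_def fun_eq_iff permutes_inverses)
  finally have "Hilbert_Choice.inv z \<circ> lact n z b = b \<circ> Hilbert_Choice.inv ?w"
    using w by (auto simp: Stab0_def fun_eq_iff permutes_inverses)
      (metis permutes_inverses(1))
  from factorization_unique[OF n inv_in_Stab0[OF z] lact_in_Cyc b inv_in_Stab0[OF w] this]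
  show ?thesis by simp
qed

section \<open>The integral\<close>

text \<open>The candidate for the integral. The condition on \<open>snd w\<close> makes it vanish
  outside \<open>Jidx n\<close>, as membership in \<open>J n\<close> demands.\<close>

definition haar :: jelem
  where "haar w = (if fst w = id \<and> snd w \<in> Cyc n then 1 / of_nat n else 0)"

lemma sum_Jidx: "sum f (Jidx n) = (\<Sum>y\<in>Stab0 n. \<Sum>b\<in>Cyc n. f (y, b))"
  by (simp add: Jidx_def sum.cartesian_product)

lemma haar_in_J: "haar \<in> J n"
  by (auto simp: J_def Jidx_def haar_def id_in_Stab0)

lemma basis_vec_in_J: "y \<in> Stab0 n \<Longrightarrow> b \<in> Cyc n \<Longrightarrow> basis_vec (y, b) \<in> J n"
  by (auto simp: J_def Jidx_def basis_vec_def)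

lemma jcounit_eq: "jcounit n h = (\<Sum>b\<in>Cyc n. h (id, b))"
proof -
  have "jcounit n h = (\<Sum>y\<in>Stab0 n. \<Sum>b\<in>Cyc n. h (y, b) * (if y = id then 1 else 0))"
    by (simp add: jcounit_def sum_Jidx)
  also have "\<dots> = (\<Sum>y\<in>Stab0 n. if y = id then (\<Sum>b\<in>Cyc n. h (y, b)) else 0)"
    by (intro sum.cong) auto
  finally show ?thesis by (simp add: finite_Stab0 id_in_Stab0)
qed

lemma jcounit_haar: "jcounit n haar = 1"
  using n by (simp add: jcounit_eq haar_def card_Cyc)

text \<open>Translation by \<open>b\<close> permutes \<open>Cyc n\<close>, so the sum does not
  depend on \<open>b\<close>. This invariance makes \<open>haar\<close> an integral.\<close>

lemma sum_basis_vec_Cyc: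
  assumes "b \<in> Cyc n"
  shows "(\<Sum>c\<in>Cyc n. basis_vec (id, b \<circ> c) w) = of_nat n * haar w"
proof -
  obtain y e where w: "w = (y, e)" by (cases w)
  have "(\<Sum>c\<in>Cyc n. basis_vec (id, b \<circ> c) w) = (\<Sum>c\<in>Cyc n. basis_vec (id, c) w)"
    by (rule sum.reindex_bij_betw[OF bij_betw_Cyc_comp[OF assms]])
  also have "\<dots> = (\<Sum>c\<in>Cyc n. if c = e then (if y = id then 1 else 0) else 0)"
    by (intro sum.cong) (auto simp: basis_vec_def w)
  also have "\<dots> = of_nat n * haar w"
    using n by (auto simp: finite_Cyc haar_def w)
  finally show ?thesis .
qed

lemma jmul_haar_right:
  "jmul n h haar = (\<lambda>w. jcounit n h * haar w)"
proof
  fix w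
  have inner: "(\<Sum>v\<in>Jidx n. h (y, b) * haar v * jmul_basis n (y, b) v w)
      = (if y = id then h (id, b) * haar w else 0)"
    if "y \<in> Stab0 n" "b \<in> Cyc n" for y b
  proof -
    \<comment> \<open>The identity is a fixed point of the action and the action is invertible, so
      only the terms with \<open>y = id\<close> survive.\<close>
    have iff: "id = ract n y b \<longleftrightarrow> y = id"
      using ract_eq_iff[OF id_in_Stab0 that] that by (auto simp: ract_id_left inv_in_Cyc)
    have "(\<Sum>v\<in>Jidx n. h (y, b) * haar v * jmul_basis n (y, b) v w)
      = (\<Sum>z\<in>Stab0 n. \<Sum>c\<in>Cyc n. h (y, b) * haar (z, c) * jmul_basis n (y, b) (z, c) w)"
      by (simp add: sum_Jidx)
    also have "\<dots> = (\<Sum>z\<in>Stab0 n. if z = id then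
        (\<Sum>c\<in>Cyc n. if y = id then h (id, b) / of_nat n * basis_vec (id, b \<circ> c) w else 0) else 0)"
      by (intro sum.cong) (auto simp: haar_def jmul_basis_def iff intro!: sum.cong)
    also have "\<dots> = (if y = id then h (id, b) / of_nat n * (of_nat n * haar w) else 0)"
      using that by (simp add: finite_Stab0 id_in_Stab0 flip: sum_basis_vec_Cyc)
        (simp add: sum_distrib_left sum_divide_distrib)
    finally show ?thesis using n by simp
  qed
  have "jmul n h haar w
      = (\<Sum>y\<in>Stab0 n. \<Sum>b\<in>Cyc n. if y = id then h (id, b) * haar w else 0)"
    unfolding jmul_def
      sum_Jidx[where f = "\<lambda>u. \<Sum>v\<in>Jidx n. h u * haar v * jmul_basis n u v w"]
    by (intro sum.cong refl inner)
  also have "\<dots> = (\<Sum>y\<in>Stab0 n. if y = id then \<Sum>b\<in>Cyc n. h (id, b) * haar w else 0)"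
    by (intro sum.cong) auto
  finally show "jmul n h haar w = jcounit n h * haar w"
    by (simp add: finite_Stab0 id_in_Stab0 jcounit_eq sum_distrib_right)
qed

lemma jmul_haar_left:
  "jmul n haar h = (\<lambda>w. jcounit n h * haar w)"
proof
  fix w
  have "(\<Sum>u\<in>Jidx n. haar u * h (z, c) * jmul_basis n u (z, c) w)
      = (if z = id then h (id, c) * haar w else 0)"
    if "z \<in> Stab0 n" "c \<in> Cyc n" for z c
  proof -
    have "(\<Sum>u\<in>Jidx n. haar u * h (z, c) * jmul_basis n u (z, c) w)
      = (\<Sum>y\<in>Stab0 n. \<Sum>b\<in>Cyc n. haar (y, b) * h (z, c) * jmul_basis n (y, b) (z, c) w)"
      by (simp add: sum_Jidx)
    also have "\<dots> = (\<Sum>y\<in>Stab0 n. if y = id then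
        (\<Sum>b\<in>Cyc n. if z = id then h (id, c) / of_nat n * basis_vec (id, c \<circ> b) w else 0) else 0)"
      using that by (intro sum.cong)
        (auto simp: haar_def jmul_basis_def ract_id_left Cyc_commute[of c] intro!: sum.cong)
    also have "\<dots> = (if z = id then h (id, c) / of_nat n * (of_nat n * haar w) else 0)"
      using that by (simp add: finite_Stab0 id_in_Stab0 flip: sum_basis_vec_Cyc)
        (simp add: sum_distrib_left sum_divide_distrib)
    finally show ?thesis using n by simp
  qed
  then have "jmul n haar h w
      = (\<Sum>z\<in>Stab0 n. \<Sum>c\<in>Cyc n. if z = id then h (id, c) * haar w else 0)"
    unfolding jmul_def by (subst sum.swap)
      (simp add: sum_Jidx[where f = "\<lambda>v. \<Sum>u\<in>Jidx n. haar u * h v * jmul_basis n u v w"]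
        cong: sum.cong)
  also have "\<dots> = (\<Sum>z\<in>Stab0 n. if z = id then \<Sum>c\<in>Cyc n. h (id, c) * haar w else 0)"
    by (intro sum.cong) auto
  finally show "jmul n haar h w = jcounit n h * haar w"
    by (simp add: finite_Stab0 id_in_Stab0 jcounit_eq sum_distrib_right)
qed

lemma jintegral_eq: "jintegral n = haar"
  unfolding jintegral_def
proof (rule the_equality)
  show "two_sided_integral n haar \<and> jcounit n haar = 1"
    by (simp add: two_sided_integral_def haar_in_J jmul_haar_left jmul_haar_right jcounit_haar)
next
  fix L assume L: "two_sided_integral n L \<and> jcounit n L = 1"
  \<comment> \<open>This product is \<open>L\<close> because \<open>L\<close> is an integral, and it
    is \<open>haar\<close> because \<open>haar\<close> is one.\<close>
  then have "jmul n haar L = (\<lambda>w. jcounit n haar * L w)"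
    by (simp add: two_sided_integral_def haar_in_J)
  with L show "L = haar" by (simp add: jmul_haar_left jcounit_haar)
qed

text \<open>The coproduct of the integral has the terms
  \<open>(p_(z^-1) # (z \<rhd> b)) \<otimes> (p_z # b)\<close>. Multiplying the two factors gives
  zero unless \<open>z^-1 \<lhd> (z \<rhd> b) = z\<close>, which by \<open>ract_inv_lact\<close>
  says \<open>z \<lhd> b = z^-1\<close>.\<close>

lemma integral_square:
  "jmul_tensor n (jcomul n (jintegral n)) =
    (\<lambda>w. \<Sum>(z, b)\<in>Jidx n. (if ract n z b = Hilbert_Choice.inv z then 1 / of_nat n else 0) *
       basis_vec (Hilbert_Choice.inv z, lact n z b \<circ> b) w)"
proof
  fix w
  let ?P = "\<lambda>z b. ((Hilbert_Choice.inv z, lact n z b), (z, b))"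
  have comul: "jcomul n haar v
      = (\<Sum>b\<in>Cyc n. \<Sum>z\<in>Stab0 n. 1 / of_nat n * basis_vec (?P z b) v)" for v
  proof -
    have "jcomul n haar v = (\<Sum>y\<in>Stab0 n. \<Sum>b\<in>Cyc n. haar (y, b) *
        (\<Sum>z\<in>Stab0 n. basis_vec ((y \<circ> Hilbert_Choice.inv z, lact n z b), (z, b)) v))"
      by (simp add: jcomul_def sum_Jidx)
    also have "\<dots> = (\<Sum>y\<in>Stab0 n. if y = id then
        (\<Sum>b\<in>Cyc n. \<Sum>z\<in>Stab0 n. 1 / of_nat n * basis_vec (?P z b) v) else 0)"
      by (intro sum.cong) (auto simp: haar_def sum_distrib_left simp del: id_apply)
    finally show ?thesis by (simp add: finite_Stab0 id_in_Stab0)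
  qed
  have delta: "(\<Sum>(u, v)\<in>Jidx n \<times> Jidx n. basis_vec (?P z b) (u, v) * jmul_basis n u v w)
      = (if ract n z b = Hilbert_Choice.inv z then 1 else 0) *
        basis_vec (Hilbert_Choice.inv z, lact n z b \<circ> b) w"
    if z: "z \<in> Stab0 n" and b: "b \<in> Cyc n" for z b
  proof -
    have "(\<Sum>(u, v)\<in>Jidx n \<times> Jidx n. basis_vec (?P z b) (u, v) * jmul_basis n u v w)
      = (\<Sum>p\<in>Jidx n \<times> Jidx n. if p = ?P z b then jmul_basis n (fst p) (snd p) w else 0)"
      by (intro sum.cong) (auto simp: basis_vec_def split: if_splits)
    also have "\<dots> = jmul_basis n (Hilbert_Choice.inv z, lact n z b) (z, b) w"
      using z b by (simp add: Jidx_def finite_Stab0 finite_Cyc inv_in_Stab0 lact_in_Cyc)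
    finally show ?thesis
      using inv_inv_Stab0[OF z] inv_inv_Stab0[OF ract_in[OF z b]]
      by (auto simp: jmul_basis_def ract_inv_lact[OF z b])
  qed
  have "jmul_tensor n (jcomul n (jintegral n)) w
      = (\<Sum>p\<in>Jidx n \<times> Jidx n. \<Sum>b\<in>Cyc n. \<Sum>z\<in>Stab0 n.
          1 / of_nat n * (basis_vec (?P z b) (fst p, snd p) * jmul_basis n (fst p) (snd p) w))"
    unfolding jmul_tensor_def jintegral_eq comul
    by (simp add: case_prod_unfold sum_distrib_right mult.assoc)
  also have "\<dots> = (\<Sum>b\<in>Cyc n. \<Sum>z\<in>Stab0 n. 1 / of_nat n *
      (\<Sum>(u, v)\<in>Jidx n \<times> Jidx n. basis_vec (?P z b) (u, v) * jmul_basis n u v w))"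
    by (subst sum.swap, intro sum.cong refl, subst sum.swap)
      (simp add: case_prod_unfold sum_distrib_left)
  also have "\<dots> = (\<Sum>b\<in>Cyc n. \<Sum>z\<in>Stab0 n.
      (if ract n z b = Hilbert_Choice.inv z then 1 / of_nat n else 0) *
       basis_vec (Hilbert_Choice.inv z, lact n z b \<circ> b) w)"
    by (intro sum.cong refl) (simp add: delta)
  also have "\<dots> = (\<Sum>(z, b)\<in>Jidx n. (if ract n z b = Hilbert_Choice.inv z then 1 / of_nat n else 0) *
       basis_vec (Hilbert_Choice.inv z, lact n z b \<circ> b) w)"
    by (subst sum.swap) (simp add: sum_Jidx)
  finally show "jmul_tensor n (jcomul n (jintegral n)) w = \<dots>" .
qed

section \<open>Evaluating characters on the square of the integral\<close>

lemma J_sum: "finite A \<Longrightarrow> (\<And>a. a \<in> A \<Longrightarrow> f a \<in> J n) \<Longrightarrow> (\<lambda>w. \<Sum>a\<in>A. g a * f a w) \<in> J n"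
  by (auto simp: J_def intro!: sum.neutral)

lemma character_sum:
  assumes \<Phi>: "J_rep n N \<Phi>" and "finite A" "\<And>a. a \<in> A \<Longrightarrow> f a \<in> J n"
  shows "character \<Phi> (\<lambda>w. \<Sum>a\<in>A. g a * f a w) = (\<Sum>a\<in>A. g a * character \<Phi> (f a))"
  using assms(2,3)
proof (induction A)
  case empty
  have car: "\<Phi> haar \<in> carrier_mat N N" using \<Phi> haar_in_J by (simp add: J_rep_def)
  \<comment> \<open>The empty sum is zero, written as a multiple of an element of \<open>J n\<close>
    so that homogeneity of \<open>\<Phi>\<close> applies.\<close>
  have "\<Phi> (\<lambda>w. 0 * haar w) = 0 \<cdot>\<^sub>m \<Phi> haar"
    using \<Phi> haar_in_J unfolding J_rep_def by blast
  with car show ?case by (simp add: character_def)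
next
  case (insert a A)
  let ?h = "\<lambda>w. g a * f a w" and ?k = "\<lambda>w. \<Sum>a\<in>A. g a * f a w"
  have fa: "f a \<in> J n" using insert by simp
  then have h: "?h \<in> J n" by (auto simp: J_def)
  have k: "?k \<in> J n" using insert by (intro J_sum) auto
  have eq: "(\<lambda>w. \<Sum>a\<in>insert a A. g a * f a w) = (\<lambda>w. ?h w + ?k w)"
    using insert by (simp add: fun_eq_iff)
  have "\<Phi> (\<lambda>w. ?h w + ?k w) = \<Phi> ?h + \<Phi> ?k" "\<Phi> ?h = g a \<cdot>\<^sub>m \<Phi> (f a)"
    using \<Phi> h k fa unfolding J_rep_def by auto
  moreover have "\<Phi> ?k \<in> carrier_mat N N" "\<Phi> (f a) \<in> carrier_mat N N"
    using \<Phi> k fa unfolding J_rep_def by blast+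
  ultimately have "character \<Phi> (\<lambda>w. ?h w + ?k w) = g a * character \<Phi> (f a) + character \<Phi> ?k"
    by (simp add: character_def sum.distrib sum_distrib_left)
  then show ?case using insert by (simp add: eq)
qed

lemma fs_indicator_J_rep:
  assumes "J_rep n N \<Phi>"
  shows "fs_indicator n (character \<Phi>) =
    (\<Sum>(z, b)\<in>Jidx n. (if ract n z b = Hilbert_Choice.inv z then 1 / of_nat n else 0) *
       character \<Phi> (basis_vec (Hilbert_Choice.inv z, lact n z b \<circ> b)))"
proof -
  let ?g = "\<lambda>(z, b). if ract n z b = Hilbert_Choice.inv z then 1 / of_nat n else 0"
  let ?f = "\<lambda>(z, b). basis_vec (Hilbert_Choice.inv z, lact n z b \<circ> b)"
  have "character \<Phi> (\<lambda>w. \<Sum>p\<in>Jidx n. ?g p * ?f p w) = (\<Sum>p\<in>Jidx n. ?g p * character \<Phi> (?f p))"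
    by (rule character_sum[OF assms])
      (auto simp: Jidx_def finite_Stab0 finite_Cyc
        intro!: basis_vec_in_J inv_in_Stab0 comp_in_Cyc lact_in_Cyc)
  then show ?thesis
    by (simp add: fs_indicator_def integral_square case_prod_unfold)
qed

section \<open>Characters of induced modules\<close>

lemma id_in_stab: "x \<in> Stab0 n \<Longrightarrow> id \<in> stab n x"
  by (simp add: stab_def id_in_Cyc ract_id)

lemma comp_in_stab: "x \<in> Stab0 n \<Longrightarrow> b \<in> stab n x \<Longrightarrow> c \<in> stab n x \<Longrightarrow> b \<circ> c \<in> stab n x"
  by (auto simp: stab_def comp_in_Cyc simp flip: ract_ract)

lemma inv_in_stab: "x \<in> Stab0 n \<Longrightarrow> b \<in> stab n x \<Longrightarrow> Hilbert_Choice.inv b \<in> stab n x"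
  using ract_eq_iff[of x x b] by (auto simp: stab_def inv_in_Cyc)

lemma finite_stab: "finite (stab n x)"
  using finite_Cyc by (simp add: stab_def)

lemma card_stab_pos: "x \<in> Stab0 n \<Longrightarrow> card (stab n x) > 0"
  using finite_stab id_in_stab by (auto simp: card_gt_0_iff)

text \<open>The induced module is the direct sum of the blocks \<open>e \<otimes> V\<close>, one for
  each coset of the stabilizer. Summing over all \<open>e\<close> in \<open>Cyc n\<close> instead of
  coset representatives counts each block as often as the stabilizer has elements, whence the factor
  on the left.\<close>

lemma induced_rep_trace:
  assumes ind: "induced_rep n x d \<rho> N \<Phi>" and rep: "group_rep (stab n x) d \<rho>"
    and x: "x \<in> Stab0 n" and y: "y \<in> Stab0 n" and b: "b \<in> Cyc n"
  shows "of_nat (card (stab n x)) * character \<Phi> (basis_vec (y, b)) =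
    (\<Sum>c\<in>Cyc n. if ract n y (b \<circ> c) = x \<and> b \<in> stab n x then \<Sum>l<d. \<rho> b $$ (l, l) else 0)"
proof -
  define F where "F = stab n x"
  define A where "A = \<Phi> (basis_vec (y, b))"
  from ind obtain \<tau> where \<Phi>: "J_rep n N \<Phi>" and \<tau>: "tensor_product n F d \<rho> N \<tau>"
    and act: "\<And>c v. c \<in> Cyc n \<Longrightarrow> v \<in> carrier_vec d \<Longrightarrow>
          A *\<^sub>v \<tau> c v = (if ract n y (b \<circ> c) = x then \<tau> (b \<circ> c) v else 0\<^sub>v N)"
    unfolding induced_rep_def F_def A_def using y b by blast
  have A: "A \<in> carrier_mat N N"
    using \<Phi> basis_vec_in_J[OF y b] by (simp add: J_rep_def A_def)
  have bal: "balanced_map n F d \<rho> N \<tau>" using \<tau> by (simp add: tensor_product_def)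
  have \<tau>_car: "\<tau> c v \<in> carrier_vec N" if "c \<in> Cyc n" "v \<in> carrier_vec d" for c v
    using bal that by (simp add: balanced_map_def)
  have \<rho>: "\<rho> f \<in> carrier_mat d d" if "f \<in> F" for f
    using rep that by (simp add: group_rep_def F_def)
  have \<rho>_mult: "\<rho> (f \<circ> g) = \<rho> f * \<rho> g" if "f \<in> F" "g \<in> F" for f g
    using rep that by (simp add: group_rep_def F_def)
  have F_Cyc: "F \<subseteq> Cyc n" by (auto simp: F_def stab_def)
  note F_id = id_in_stab[OF x, folded F_def] and F_comp = comp_in_stab[OF x, folded F_def]
    and F_inv = inv_in_stab[OF x, folded F_def]

  text \<open>\<open>\<sigma> e\<close> is the projection of \<open>\<complex>C\<^sub>n \<otimes> V\<close> to its summand \<open>e \<otimes> V\<close>, identified with \<open>V\<close>.\<close>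
  define \<sigma> where "\<sigma> e c v = (if Hilbert_Choice.inv e \<circ> c \<in> F
      then \<rho> (Hilbert_Choice.inv e \<circ> c) *\<^sub>v v else 0\<^sub>v d)" for e c :: perm and v
  have "balanced_map n F d \<rho> d (\<sigma> e)" if "e \<in> Cyc n" for e
    unfolding balanced_map_def
  proof (intro ballI conjI allI)
    fix c f and v :: "complex vec"
    assume c: "c \<in> Cyc n" and f: "f \<in> F" and v: "v \<in> carrier_vec d"
    let ?g = "Hilbert_Choice.inv e \<circ> c"
    have "f \<in> Cyc n" using f F_Cyc by auto
    then have "?g \<circ> f \<circ> Hilbert_Choice.inv f = ?g" by (simp add: Cyc_inv comp_assoc)
    then have "?g \<circ> f \<in> F \<longleftrightarrow> ?g \<in> F"
      using F_comp[OF _ f, of ?g] F_comp[OF _ F_inv[OF f], of "?g \<circ> f"] by auto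
    then show "\<sigma> e (c \<circ> f) v = \<sigma> e c (\<rho> f *\<^sub>v v)"
      using f v \<rho>[OF f] \<rho>[of ?g] by (auto simp: \<sigma>_def \<rho>_mult simp flip: comp_assoc)
  qed (use \<rho> in \<open>auto simp: \<sigma>_def mult_add_distrib_mat_vec[of _ d d] mult_mat_vec[of _ d d]
    intro!: mult_mat_vec_carrier\<close>)
  \<comment> \<open>The universal property turns \<open>\<sigma> e\<close> into a matrix
    \<open>L e\<close> from the tensor product to \<open>V\<close>; \<open>M e\<close> below is the
    inclusion of \<open>V\<close> as \<open>e \<otimes> V\<close>.\<close>
  then have "\<exists>L. L \<in> carrier_mat d N \<and> (\<forall>c\<in>Cyc n. \<forall>v\<in>carrier_vec d. L *\<^sub>v \<tau> c v = \<sigma> e c v)"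
    if "e \<in> Cyc n" for e
    using \<tau> that unfolding tensor_product_def by blast
  then obtain L where L: "\<And>e. e \<in> Cyc n \<Longrightarrow> L e \<in> carrier_mat d N"
    and L\<tau>: "\<And>e c v. e \<in> Cyc n \<Longrightarrow> c \<in> Cyc n \<Longrightarrow> v \<in> carrier_vec d \<Longrightarrow> L e *\<^sub>v \<tau> c v = \<sigma> e c v"
    by metis
  have "\<exists>M. M \<in> carrier_mat N d \<and> (\<forall>v\<in>carrier_vec d. \<tau> e v = M *\<^sub>v v)" if "e \<in> Cyc n" for e
    by (rule linear_map_matrix[of d "\<tau> e" N]) (use bal that in \<open>auto simp: balanced_map_def\<close>)
  then obtain M where M: "\<And>e. e \<in> Cyc n \<Longrightarrow> M e \<in> carrier_mat N d"
    and M\<tau>: "\<And>e v. e \<in> Cyc n \<Longrightarrow> v \<in> carrier_vec d \<Longrightarrow> \<tau> e v = M e *\<^sub>v v"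
    by metis

  \<comment> \<open>\<open>M e * L e\<close> is the projection onto the block
    \<open>e \<otimes> V\<close>.\<close>
  have proj_\<tau>: "(M e * L e) *\<^sub>v \<tau> c v = (if Hilbert_Choice.inv e \<circ> c \<in> F then \<tau> c v else 0\<^sub>v N)"
    if e: "e \<in> Cyc n" and c: "c \<in> Cyc n" and v: "v \<in> carrier_vec d" for e c v
  proof -
    let ?g = "Hilbert_Choice.inv e \<circ> c"
    have "(M e * L e) *\<^sub>v \<tau> c v = M e *\<^sub>v \<sigma> e c v"
      using L[OF e] M[OF e] \<tau>_car[OF c v] by (simp add: L\<tau>[OF e c v])
    moreover have "M e *\<^sub>v (\<rho> ?g *\<^sub>v v) = \<tau> c v" if g: "?g \<in> F"
    proof -
      have "M e *\<^sub>v (\<rho> ?g *\<^sub>v v) = \<tau> e (\<rho> ?g *\<^sub>v v)"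
        using M\<tau>[OF e] \<rho>[OF g] v by simp
      also have "\<dots> = \<tau> (e \<circ> ?g) v"
        using bal e g v by (simp add: balanced_map_def)
      also have "e \<circ> ?g = c" by (simp add: Cyc_inv[OF e] flip: comp_assoc)
      finally show ?thesis .
    qed
    ultimately show ?thesis using M[OF e] by (auto simp: \<sigma>_def)
  qed

  define S where "S = mat N N (\<lambda>p. \<Sum>e\<in>Cyc n. (M e * L e) $$ p)"
  let ?k = "of_nat (card F) :: complex"
  \<comment> \<open>The elements counted here form the coset of \<open>c\<close> modulo
    \<open>F\<close>.\<close>
  have card_coset: "card {e \<in> Cyc n. Hilbert_Choice.inv e \<circ> c \<in> F} = card F" if c: "c \<in> Cyc n" for c
  proof -
    have "bij_betw (\<lambda>f. c \<circ> Hilbert_Choice.inv f) F {e \<in> Cyc n. Hilbert_Choice.inv e \<circ> c \<in> F}"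
    proof (rule bij_betwI[where g = "\<lambda>e. Hilbert_Choice.inv e \<circ> c"])
      have eq: "Hilbert_Choice.inv (c \<circ> Hilbert_Choice.inv f) \<circ> c = f" if "f \<in> Cyc n" for f
        using c that by (auto simp: Cyc_eq shift_int_add inv_shift_int)
      show "(\<lambda>f. c \<circ> Hilbert_Choice.inv f) \<in> F \<rightarrow> {e \<in> Cyc n. Hilbert_Choice.inv e \<circ> c \<in> F}"
        using c F_Cyc eq by (auto intro!: comp_in_Cyc inv_in_Cyc)
      show "Hilbert_Choice.inv (c \<circ> Hilbert_Choice.inv f) \<circ> c = f" if "f \<in> F" for f
        using that F_Cyc eq by auto
      show "c \<circ> Hilbert_Choice.inv (Hilbert_Choice.inv e \<circ> c) = e"
        if "e \<in> {e \<in> Cyc n. Hilbert_Choice.inv e \<circ> c \<in> F}" for e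
        using c that by (auto simp: Cyc_eq shift_int_add inv_shift_int)
    qed auto
    then show ?thesis by (simp add: bij_betw_same_card)
  qed
  have S_apply: "(S *\<^sub>v w) $ p = (\<Sum>e\<in>Cyc n. ((M e * L e) *\<^sub>v w) $ p)"
    if "p < N" "w \<in> carrier_vec N" for p w
  proof -
    have "(S *\<^sub>v w) $ p = (\<Sum>q<N. \<Sum>e\<in>Cyc n. (M e * L e) $$ (p, q) * w $ q)"
      using that by (simp add: S_def mult_mat_vec_index[of _ N N] sum_distrib_right
          del: index_mult_mat_vec)
    also have "\<dots> = (\<Sum>e\<in>Cyc n. \<Sum>q<N. (M e * L e) $$ (p, q) * w $ q)" by (rule sum.swap)
    also have "\<dots> = (\<Sum>e\<in>Cyc n. ((M e * L e) *\<^sub>v w) $ p)"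
    proof (intro sum.cong refl)
      fix e assume "e \<in> Cyc n"
      then have "M e * L e \<in> carrier_mat N N" using L M by (auto intro: mult_carrier_mat)
      then show "(\<Sum>q<N. (M e * L e) $$ (p, q) * w $ q) = ((M e * L e) *\<^sub>v w) $ p"
        using that by (simp add: mult_mat_vec_index del: index_mult_mat_vec)
    qed
    finally show ?thesis .
  qed
  have S\<tau>: "S *\<^sub>v \<tau> c v = ?k \<cdot>\<^sub>v \<tau> c v" if c: "c \<in> Cyc n" and v: "v \<in> carrier_vec d" for c v
  proof (rule eq_vecI)
    note car = \<tau>_car[OF c v]
    fix p assume "p < dim_vec (?k \<cdot>\<^sub>v \<tau> c v)"
    with car have p: "p < N" by simp
    have "(S *\<^sub>v \<tau> c v) $ p
        = (\<Sum>e\<in>Cyc n. if Hilbert_Choice.inv e \<circ> c \<in> F then \<tau> c v $ p else 0)"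
      unfolding S_apply[OF p car] using p by (intro sum.cong refl) (simp add: proj_\<tau>[OF _ c v])
    also have "\<dots> = ?k * \<tau> c v $ p"
      using card_coset[OF c] by (simp add: finite_Cyc flip: sum.inter_filter)
    finally show "(S *\<^sub>v \<tau> c v) $ p = (?k \<cdot>\<^sub>v \<tau> c v) $ p" using p car by simp
  qed (use \<tau>_car[OF c v] in \<open>simp add: S_def\<close>)
  \<comment> \<open>Both \<open>S\<close> and the scalar matrix \<open>?k\<close> factor this
    balanced map through the tensor product, so the uniqueness part of the universal property
    equates them. It takes the place of a spanning argument.\<close>
  have "balanced_map n F d \<rho> N (\<lambda>c v. ?k \<cdot>\<^sub>v \<tau> c v)"
    using bal by (auto simp: balanced_map_def smult_add_distrib_vec[of _ N] smult_smult_assoc mult.commute)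
  then have "\<exists>!T. T \<in> carrier_mat N N \<and>
      (\<forall>c\<in>Cyc n. \<forall>v\<in>carrier_vec d. T *\<^sub>v \<tau> c v = ?k \<cdot>\<^sub>v \<tau> c v)"
    using \<tau> unfolding tensor_product_def by blast
  then have uniq: "T = T'"
    if "T \<in> carrier_mat N N \<and> (\<forall>c\<in>Cyc n. \<forall>v\<in>carrier_vec d. T *\<^sub>v \<tau> c v = ?k \<cdot>\<^sub>v \<tau> c v)"
      "T' \<in> carrier_mat N N \<and> (\<forall>c\<in>Cyc n. \<forall>v\<in>carrier_vec d. T' *\<^sub>v \<tau> c v = ?k \<cdot>\<^sub>v \<tau> c v)"
    for T T'
    using that by (rule Ex1_unique)
  have scalar: "(?k \<cdot>\<^sub>m 1\<^sub>m N) *\<^sub>v w = ?k \<cdot>\<^sub>v w" if "w \<in> carrier_vec N" for w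
    using that by (intro eq_vecI)
      (auto simp: mult_mat_vec_index[of _ N N] mult.assoc if_distrib[of "\<lambda>z. z * _"]
        simp flip: sum_distrib_left cong: if_cong)
  have S: "S = ?k \<cdot>\<^sub>m 1\<^sub>m N"
    by (intro uniq conjI ballI S\<tau> scalar \<tau>_car) (simp_all add: S_def)

  \<comment> \<open>The left side is the trace of \<open>A * S\<close>, which is now split into the
    contributions of the projections.\<close>
  have "?k * character \<Phi> (basis_vec (y, b)) = (\<Sum>p<N. \<Sum>q<N. A $$ (p, q) * S $$ (q, p))"
    using A unfolding S by (simp add: character_def A_def[symmetric] sum_distrib_left
        if_distrib[of "\<lambda>z. _ * z"] mult.commute cong: if_cong)
  also have "\<dots> = (\<Sum>p<N. \<Sum>q<N. \<Sum>e\<in>Cyc n. A $$ (p, q) * (M e * L e) $$ (q, p))"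
    by (simp add: S_def sum_distrib_left)
  also have "\<dots> = (\<Sum>e\<in>Cyc n. \<Sum>p<N. \<Sum>q<N. A $$ (p, q) * (M e * L e) $$ (q, p))"
    by (subst sum.swap[of _ "Cyc n"]) (intro sum.cong refl sum.swap)
  also have "\<dots> = (\<Sum>e\<in>Cyc n. if ract n y (b \<circ> e) = x \<and> b \<in> F then \<Sum>l<d. \<rho> b $$ (l, l) else 0)"
  proof (intro sum.cong refl)
    fix e assume e: "e \<in> Cyc n"
    note LM = L[OF e] M[OF e]
    have "M e * L e \<in> carrier_mat N N" using LM by auto
    then have "(\<Sum>p<N. \<Sum>q<N. A $$ (p, q) * (M e * L e) $$ (q, p))
        = (\<Sum>p<N. (A * (M e * L e)) $$ (p, p))"
      using A by (simp add: mult_mat_index del: index_mult_mat)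
    also have "A * (M e * L e) = (A * M e) * L e"
      using A LM by simp
    \<comment> \<open>By cyclicity of the trace it remains to study the \<open>d\<close> by
      \<open>d\<close> matrix of \<open>A\<close> on the block of \<open>e\<close>.\<close>
    also have "(\<Sum>p<N. ((A * M e) * L e) $$ (p, p)) = (\<Sum>l<d. (L e * (A * M e)) $$ (l, l))"
      using A LM by (intro sum_diag_mult_commute) auto
    also have "\<dots> = (if ract n y (b \<circ> e) = x \<and> b \<in> F then \<Sum>l<d. \<rho> b $$ (l, l) else 0)"
    proof -
      have be: "b \<circ> e \<in> Cyc n" using b e by (rule comp_in_Cyc)
      \<comment> \<open>By commutativity \<open>b\<close> sends the block of \<open>e\<close> to
        itself exactly if \<open>b\<close> lies in \<open>F\<close>, and then it acts there as
        \<open>\<rho> b\<close>.\<close>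
      have b_eq: "Hilbert_Choice.inv e \<circ> (b \<circ> e) = b"
        unfolding Cyc_commute[OF b e] by (simp add: Cyc_inv[OF e] flip: comp_assoc)
      have "(L e * (A * M e)) $$ (l, l)
          = (if ract n y (b \<circ> e) = x \<and> b \<in> F then \<rho> b $$ (l, l) else 0)" if l: "l < d" for l
      proof -
        let ?u = "unit_vec d l :: complex vec"
        have u: "?u \<in> carrier_vec d" by simp
        have unit: "B $$ (l, l) = (B *\<^sub>v ?u) $ l" if "B \<in> carrier_mat d d" for B :: "complex mat"
          using that l by (simp add: scalar_prod_right_unit)
        have "(L e * (A * M e)) *\<^sub>v ?u = L e *\<^sub>v (A *\<^sub>v \<tau> e ?u)"
          using A LM u
          by (simp add: M\<tau>[OF e u] assoc_mult_mat_vec[of _ d N _ d] assoc_mult_mat_vec[of _ N N _ d])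
        also have "\<dots> = (if ract n y (b \<circ> e) = x \<and> b \<in> F then \<rho> b *\<^sub>v ?u else 0\<^sub>v d)"
          using LM by (auto simp: act[OF e u] L\<tau>[OF e be u] \<sigma>_def b_eq intro!: eq_vecI)
        finally have "((L e * (A * M e)) *\<^sub>v ?u) $ l
          = (if ract n y (b \<circ> e) = x \<and> b \<in> F then (\<rho> b *\<^sub>v ?u) $ l else 0)"
          using l by simp
        moreover have "L e * (A * M e) \<in> carrier_mat d d" using LM A by auto
        ultimately show ?thesis using unit[of "L e * (A * M e)"] unit[OF \<rho>, of b] by simp
      qed
      then show ?thesis by (cases "ract n y (b \<circ> e) = x \<and> b \<in> F") (simp_all only: if_True if_False, simp_all)
    qed
    finally show "(\<Sum>p<N. \<Sum>q<N. A $$ (p, q) * (M e * L e) $$ (q, p))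
      = (if ract n y (b \<circ> e) = x \<and> b \<in> F then \<Sum>l<d. \<rho> b $$ (l, l) else 0)" .
  qed
  finally show ?thesis by (simp add: F_def)
qed

section \<open>The indicator as a sum over the orbit\<close>

text \<open>The contribution of \<open>z = y^-1\<close> to the indicator. \<open>F\<close> and
  \<open>f\<close> are parameters, so that one and the same function serves all members of an
  orbit.\<close>

definition orbit_term :: "perm set \<Rightarrow> (perm \<Rightarrow> complex) \<Rightarrow> perm \<Rightarrow> complex"
  where "orbit_term F f y = (\<Sum>b\<in>Cyc n.
    if ract n (Hilbert_Choice.inv y) b = y \<and> lact n (Hilbert_Choice.inv y) b \<circ> b \<in> F
    then f (lact n (Hilbert_Choice.inv y) b \<circ> b) else 0)"

text \<open>The trace formula leaves only those \<open>z\<close> whose inverse lies in the orbit of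
  \<open>x\<close>. Each orbit member is counted once for every \<open>c\<close> that produces
  it.\<close>

lemma fs_indicator_induced:
  assumes ind: "induced_rep n x d \<rho> N \<Phi>" and rep: "group_rep (stab n x) d \<rho>"
    and x: "x \<in> Stab0 n"
  shows "of_nat n * of_nat (card (stab n x)) * fs_indicator n (character \<Phi>) =
    (\<Sum>c\<in>Cyc n. orbit_term (stab n x) (\<lambda>b. \<Sum>l<d. \<rho> b $$ (l, l)) (ract n x c))"
proof -
  let ?F = "stab n x" and ?f = "\<lambda>b. \<Sum>l<d. \<rho> b $$ (l, l)"
  let ?k = "of_nat (card ?F) :: complex"
  define g where "g z b = lact n z b \<circ> b" for z b
  have g: "g z b \<in> Cyc n" if "b \<in> Cyc n" for z b
    unfolding g_def using that by (intro comp_in_Cyc lact_in_Cyc)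
  let ?inv = "Hilbert_Choice.inv :: perm \<Rightarrow> perm"
  have J: "J_rep n N \<Phi>" using ind by (simp add: induced_rep_def)
  have inner: "?k * character \<Phi> (basis_vec (?inv z, g z b)) =
      (\<Sum>c\<in>Cyc n. if ?inv z = ract n x (?inv c) \<and> g z b \<in> ?F then ?f (g z b) else 0)"
    if z: "z \<in> Stab0 n" and b: "b \<in> Cyc n" for z b
  proof -
    \<comment> \<open>By commutativity \<open>g z b\<close> can be applied last, and being in the
      stabilizer it has no effect on \<open>x\<close>.\<close>
    have "ract n (?inv z) (g z b \<circ> c) = x \<longleftrightarrow> ?inv z = ract n x (?inv c)"
      if c: "c \<in> Cyc n" and gF: "g z b \<in> ?F" for c
    proof -
      have iz: "?inv z \<in> Stab0 n" by (rule inv_in_Stab0[OF z])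
      have "ract n (?inv z) (g z b \<circ> c) = ract n (ract n (?inv z) c) (g z b)"
        using c g[OF b] iz by (simp add: ract_ract Cyc_commute)
      moreover have "ract n x (?inv (g z b)) = x"
        using inv_in_stab[OF x gF] by (simp add: stab_def)
      ultimately show ?thesis
        using ract_eq_iff[OF x ract_in[OF iz c] g[OF b]] ract_eq_iff[OF x iz c] by simp
    qed
    then have iff: "ract n (?inv z) (g z b \<circ> c) = x \<and> g z b \<in> ?F
        \<longleftrightarrow> ?inv z = ract n x (?inv c) \<and> g z b \<in> ?F" if "c \<in> Cyc n" for c
      using that by blast
    show ?thesis
      unfolding induced_rep_trace[OF ind rep x inv_in_Stab0[OF z] g[OF b]]
      by (rule sum.cong[OF refl]) (simp only: iff)
  qed
  have "of_nat n * ?k * fs_indicator n (character \<Phi>) = (\<Sum>z\<in>Stab0 n. \<Sum>b\<in>Cyc n.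
      if ract n z b = ?inv z then ?k * character \<Phi> (basis_vec (?inv z, g z b)) else 0)"
    using n unfolding fs_indicator_J_rep[OF J] sum_Jidx g_def
    by (simp add: sum_distrib_left) (intro sum.cong, auto)
  also have "\<dots> = (\<Sum>z\<in>Stab0 n. \<Sum>b\<in>Cyc n. \<Sum>c\<in>Cyc n.
      if ?inv z = ract n x (?inv c) then
        if ract n z b = ?inv z \<and> g z b \<in> ?F then ?f (g z b) else 0 else 0)"
    by (intro sum.cong refl) (auto simp: inner intro!: sum.cong)
  also have "\<dots> = (\<Sum>z\<in>Stab0 n. \<Sum>c\<in>Cyc n. if ?inv z = ract n x (?inv c)
      then orbit_term ?F ?f (?inv z) else 0)"
  proof (rule sum.cong[OF refl])
    fix z assume z: "z \<in> Stab0 n"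
    show "(\<Sum>b\<in>Cyc n. \<Sum>c\<in>Cyc n. if ?inv z = ract n x (?inv c) then
        if ract n z b = ?inv z \<and> g z b \<in> ?F then ?f (g z b) else 0 else 0) =
      (\<Sum>c\<in>Cyc n. if ?inv z = ract n x (?inv c) then orbit_term ?F ?f (?inv z) else 0)"
    proof (subst sum.swap, rule sum.cong[OF refl])
      fix c
      show "(\<Sum>b\<in>Cyc n. if ?inv z = ract n x (?inv c) then
          if ract n z b = ?inv z \<and> g z b \<in> ?F then ?f (g z b) else 0 else 0) =
        (if ?inv z = ract n x (?inv c) then orbit_term ?F ?f (?inv z) else 0)"
        unfolding orbit_term_def inv_inv_Stab0[OF z] g_def
        by (cases "?inv z = ract n x (?inv c)") simp_all
    qed
  qed
  also have "\<dots> = (\<Sum>y\<in>Stab0 n. \<Sum>c\<in>Cyc n. if y = ract n x (?inv c)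
      then orbit_term ?F ?f y else 0)"
    by (rule sum.reindex_bij_betw[of ?inv])
      (auto intro!: bij_betwI[where g = ?inv] simp: inv_in_Stab0 inv_inv_Stab0)
  also have "\<dots> = (\<Sum>c\<in>Cyc n. \<Sum>y\<in>Stab0 n. if y = ract n x (?inv c)
      then orbit_term ?F ?f y else 0)"
    by (rule sum.swap)
  also have "\<dots> = (\<Sum>c\<in>Cyc n. orbit_term ?F ?f (ract n x (?inv c)))"
    using x by (intro sum.cong) (auto simp: finite_Stab0 ract_in inv_in_Cyc)
  also have "\<dots> = (\<Sum>c\<in>Cyc n. orbit_term ?F ?f (ract n x c))"
    by (rule sum.reindex_bij_betw[OF bij_betw_Cyc_inv])
  finally show ?thesis .
qed

text \<open>Starting at \<open>y = x \<lhd> c0\<close> instead of \<open>x\<close> only translates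
  the summation variable by \<open>c0\<close>.\<close>

lemma fs_indicator_orbit:
  assumes x: "x \<in> Stab0 n" and y: "y \<in> orb n x"
    and "induced_rep n x d \<rho> N \<Phi>" "induced_rep n y d \<rho> N' \<Phi>'" and rep: "group_rep (stab n x) d \<rho>"
  shows "fs_indicator n (character \<Phi>) = fs_indicator n (character \<Phi>')"
proof -
  let ?t = "orbit_term (stab n x) (\<lambda>b. \<Sum>l<d. \<rho> b $$ (l, l))"
  obtain c0 where c0: "c0 \<in> Cyc n" "y = ract n x c0" using y by (auto simp: orb_def)
  have stab: "stab n y = stab n x" unfolding c0 by (rule stab_ract[OF x c0(1)])
  have "y \<in> Stab0 n" unfolding c0 by (rule ract_in[OF x c0(1)])
  from fs_indicator_induced[OF assms(4) rep[folded stab] this]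
  have "of_nat n * of_nat (card (stab n x)) * fs_indicator n (character \<Phi>')
      = (\<Sum>c\<in>Cyc n. ?t (ract n x (c0 \<circ> c)))"
    unfolding stab using x c0 by (simp add: ract_ract)
  also have "\<dots> = (\<Sum>c\<in>Cyc n. ?t (ract n x c))"
    by (rule sum.reindex_bij_betw[OF bij_betw_Cyc_comp[OF c0(1)]])
  also have "\<dots> = of_nat n * of_nat (card (stab n x)) * fs_indicator n (character \<Phi>)"
    using fs_indicator_induced[OF assms(3) rep x] by simp
  finally show ?thesis using n card_stab_pos[OF x] by simp
qed

section \<open>Evaluation of the indicator\<close>

context
  fixes x :: perm and t s :: nat and j :: int
  assumes x: "x \<in> Stab0 n" and t: "t > 0" "t dvd n"
    and stab: "stab n x = {(shift n ^^ t) ^^ k | k. True}"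
    and xt: "[int (x (t mod n)) = j * int t] (mod int n)"
    and s: "Hilbert_Choice.inv x = ract n x (shift n ^^ s)"
begin

lemma n_eq_mult: "int n = int t * int (n div t)"
  using t by (simp flip: of_nat_mult)

lemma quotient_pos: "int (n div t) > 0"
  using n t by (simp add: dvd_imp_le div_greater_zero_iff)

text \<open>This passes from exponents of \<open>a\<close> modulo \<open>n\<close> to exponents of
  the generator \<open>a^t\<close> modulo \<open>n/t\<close>.\<close>

lemma cong_mult_t_iff: "[int t * a = int t * b] (mod int n) \<longleftrightarrow> [a = b] (mod int (n div t))"
  unfolding n_eq_mult cong_iff_dvd_diff right_diff_distrib[symmetric] using t by simp

lemma shift_int_in_stab_iff: "shift_int n i \<in> stab n x \<longleftrightarrow> int t dvd i"
proof -
  have pow_pow: "(shift n ^^ t) ^^ k = shift_int n (int (t * k))" for k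
    unfolding funpow_mult by (rule shift_pow_eq)
  show ?thesis
  proof
    assume "shift_int n i \<in> stab n x"
    then obtain k where "shift_int n i = (shift n ^^ t) ^^ k" unfolding stab by blast
    then have "[i = int (t * k)] (mod int n)"
      unfolding pow_pow shift_int_eq_iff .
    then have "[i = int (t * k)] (mod int t)"
      using t by (auto intro: cong_dvd_modulus)
    then show "int t dvd i" by (simp add: cong_dvd_iff)
  next
    assume "int t dvd i"
    then obtain k where k: "i = int t * k" by blast
    have "[int t * k = int t * (k mod int (n div t))] (mod int n)"
      unfolding cong_mult_t_iff by (simp add: cong_def)
    then have "shift_int n i = shift_int n (int (t * nat (k mod int (n div t))))"
      using quotient_pos by (simp add: k shift_int_eq_iff)
    then have "shift_int n i = (shift n ^^ t) ^^ nat (k mod int (n div t))"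
      unfolding pow_pow .
    then show "shift_int n i \<in> stab n x" unfolding stab by blast
  qed
qed

section \<open>Functional equations for \<open>x\<close> and inversion on its orbit\<close>

text \<open>Since \<open>a^(tk)\<close> fixes \<open>x\<close>, the value formula for
  \<open>ract\<close> gives \<open>x(i) = x(i + tk) - x(tk)\<close>.\<close>

lemma perm_int_add_multiple: "[perm_int n x (i + int t * k) = perm_int n x i + perm_int n x (int t * k)] (mod int n)"
proof -
  have "ract n x (shift_int n (int t * k)) = x"
    using shift_int_in_stab_iff[of "int t * k"] by (simp add: stab_def)
  with perm_int_ract[OF x, of "int t * k" i]
  have "[perm_int n x i + perm_int n x (int t * k)
      = perm_int n x (i + int t * k) - perm_int n x (int t * k) + perm_int n x (int t * k)] (mod int n)"
    by (intro cong_add cong_refl) simp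
  then show ?thesis by (simp add: cong_sym)
qed

text \<open>On multiples of \<open>t\<close> the function is additive, so it is determined by
  \<open>x(t) = jt\<close>. The induction runs in both directions from 0.\<close>

lemma perm_int_multiple: "[perm_int n x (int t * k) = j * int t * k] (mod int n)"
proof (induction k rule: int_induct[of _ 0])
  case base
  then show ?case by (simp add: perm_int_0[OF x])
next
  case (step1 i)
  have "perm_int n x (int t) = int (x (t mod n))" by (simp add: perm_int_def flip: zmod_int)
  then have "[perm_int n x (int t) = j * int t] (mod int n)" using xt by simp
  with step1 have "[perm_int n x (int t * i) + perm_int n x (int t) = j * int t * i + j * int t] (mod int n)" by (intro cong_add)
  with perm_int_add_multiple[of "int t * i" 1] show ?case by (auto simp: algebra_simps intro: cong_trans)
next
  case (step2 i)
  have "perm_int n x (int t) = int (x (t mod n))" by (simp add: perm_int_def flip: zmod_int)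
  then have T: "[perm_int n x (int t) = j * int t] (mod int n)" using xt by simp
  have "[perm_int n x (int t * (i - 1)) + perm_int n x (int t) = perm_int n x (int t * i)] (mod int n)"
    using cong_sym[OF perm_int_add_multiple[of "int t * (i - 1)" 1]] by (simp add: algebra_simps)
  then have "[perm_int n x (int t * (i - 1)) + perm_int n x (int t) - perm_int n x (int t) = j * int t * i - j * int t] (mod int n)"
    by (intro cong_diff T cong_trans[OF _ step2(2)])
  then show ?case by (simp add: algebra_simps)
qed

lemma perm_int_periodic: "[perm_int n x (i + int t * k) = perm_int n x i + j * int t * k] (mod int n)"
  by (rule cong_trans[OF perm_int_add_multiple]) (intro cong_add cong_refl perm_int_multiple)

text \<open>The hypothesis on \<open>s\<close> says \<open>x^-1(i) = x(i + s) - x(s)\<close>; here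
  it is evaluated at \<open>x(i)\<close>.\<close>

lemma perm_int_perm_int: "[perm_int n x (int s + perm_int n x i) = i + perm_int n x (int s)] (mod int n)"
proof -
  have "[perm_int n x (perm_int n x i + int s) - perm_int n x (int s) = i] (mod int n)"
    by (rule cong_trans[OF cong_sym[OF perm_int_ract[OF x]] perm_int_inv[OF x, unfolded s shift_pow_eq]])
  from cong_add[OF this cong_refl[of "perm_int n x (int s)"]] show ?thesis by (simp add: add.commute)
qed

text \<open>The orbit is thus indexed by the residues modulo \<open>t\<close>.\<close>

lemma ract_shift_int_eq_iff:
  "ract n x (shift_int n p) = ract n x (shift_int n q) \<longleftrightarrow> int t dvd p - q"
proof -
  have c: "shift_int n i \<in> Cyc n" for i by (simp add: Cyc_eq)
  have "ract n x (shift_int n p) = ract n x (shift_int n q)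
      \<longleftrightarrow> ract n (ract n x (shift_int n p)) (shift_int n (- q)) = x"
    using ract_eq_iff[OF x ract_in[OF x c] c, of p "- q"]
    by (simp add: inv_shift_int)
  also have "\<dots> \<longleftrightarrow> ract n x (shift_int n (p - q)) = x"
    by (simp add: ract_ract[OF x c c] shift_int_add)
  also have "\<dots> \<longleftrightarrow> int t dvd p - q"
    using shift_int_in_stab_iff[of "p - q"] c by (simp add: stab_def)
  finally show ?thesis .
qed

text \<open>Apply \<open>ract_inv_lact\<close> and replace \<open>x^-1\<close> by
  \<open>x \<lhd> a^s\<close>. On indices of orbit members, inversion becomes the map from
  \<open>u\<close> to \<open>s + x(u)\<close>.\<close>

lemma inv_ract:
  "Hilbert_Choice.inv (ract n x (shift_int n u)) = ract n x (shift_int n (int s + perm_int n x u))"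
proof -
  have c: "shift_int n i \<in> Cyc n" for i by (simp add: Cyc_eq)
  show ?thesis
    unfolding ract_inv_lact[OF x c, symmetric] lact_shift_int s shift_pow_eq
    by (simp add: ract_ract[OF x c c] shift_int_add)
qed

text \<open>The right side does not mention \<open>u\<close>: all orbit members contribute equally.
  With \<open>w = s + x(u)\<close>, the admissible \<open>b\<close> are the
  \<open>a^(u - w + tk)\<close>, and in the exponent of \<open>(y^-1 \<rhd> b) b\<close> the terms
  in \<open>u\<close> cancel because \<open>x(w) = u + x(s)\<close>.\<close>

lemma orbit_term_eq:
  "orbit_term (stab n x) f (ract n x (shift_int n u)) =
    (\<Sum>k\<in>{0..<int (n div t)}. if int t dvd perm_int n x (int s) + int s
      then f (shift_int n ((j + 1) * int t * k - (perm_int n x (int s) + int s))) else 0)"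
proof -
  let ?y = "ract n x (shift_int n u)" and ?w = "int s + perm_int n x u"
  let ?b = "\<lambda>k. shift_int n (u - ?w + int t * k)"
  let ?g = "\<lambda>b. lact n (Hilbert_Choice.inv ?y) b \<circ> b"
  have c: "shift_int n i \<in> Cyc n" for i by (simp add: Cyc_eq)
  have cond: "ract n (Hilbert_Choice.inv ?y) (shift_int n r) = ?y \<longleftrightarrow> int t dvd r - (u - ?w)" for r
    by (simp add: inv_ract ract_ract[OF x c c] shift_int_add ract_shift_int_eq_iff algebra_simps)
  have g: "?g (?b k) = shift_int n ((j + 1) * int t * k - (perm_int n x (int s) + int s))" for k
  proof -
    have "[perm_int n (ract n x (shift_int n ?w)) (u - ?w + int t * k)
        = perm_int n x (u + int t * k) - perm_int n x ?w] (mod int n)"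
      using perm_int_ract[OF x, of ?w "u - ?w + int t * k"] by (simp add: algebra_simps)
    then have "[perm_int n (ract n x (shift_int n ?w)) (u - ?w + int t * k)
        = (perm_int n x u + j * int t * k) - (u + perm_int n x (int s))] (mod int n)"
      by (rule cong_trans) (intro cong_diff perm_int_periodic perm_int_perm_int)
    then have "[perm_int n (ract n x (shift_int n ?w)) (u - ?w + int t * k) + (u - ?w + int t * k)
        = (perm_int n x u + j * int t * k) - (u + perm_int n x (int s)) + (u - ?w + int t * k)] (mod int n)"
      by (intro cong_add cong_refl)
    then show ?thesis
      by (simp add: inv_ract lact_shift_int shift_int_add shift_int_eq_iff algebra_simps)
  qed
  have inj: "inj_on ?b {0..<int (n div t)}"
  proof (rule inj_onI)
    fix k l assume kl: "k \<in> {0..<int (n div t)}" "l \<in> {0..<int (n div t)}" "?b k = ?b l"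
    then have "[k = l] (mod int (n div t))" by (simp add: shift_int_eq_iff cong_add_lcancel cong_mult_t_iff)
    with kl show "k = l" by (simp add: cong_def)
  qed
  have image: "{b \<in> Cyc n. ract n (Hilbert_Choice.inv ?y) b = ?y} = ?b ` {0..<int (n div t)}"
  proof (intro equalityI subsetI)
    fix b assume "b \<in> {b \<in> Cyc n. ract n (Hilbert_Choice.inv ?y) b = ?y}"
    then obtain r where r: "b = shift_int n r" "int t dvd r - (u - ?w)"
      using cond by (auto simp: Cyc_eq)
    then obtain k where k: "r - (u - ?w) = int t * k" by blast
    have "[u - ?w + int t * k = u - ?w + int t * (k mod int (n div t))] (mod int n)"
      unfolding cong_add_lcancel cong_mult_t_iff by (simp add: cong_def)
    moreover have "r = u - ?w + int t * k" using k by simp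
    ultimately have "b = ?b (k mod int (n div t))" by (simp add: r(1) shift_int_eq_iff)
    then show "b \<in> ?b ` {0..<int (n div t)}" using quotient_pos by auto
  next
    fix b assume "b \<in> ?b ` {0..<int (n div t)}"
    then show "b \<in> {b \<in> Cyc n. ract n (Hilbert_Choice.inv ?y) b = ?y}"
      using c cond by auto
  qed
  have "orbit_term (stab n x) f ?y
      = (\<Sum>b\<in>{b \<in> Cyc n. ract n (Hilbert_Choice.inv ?y) b = ?y}. if ?g b \<in> stab n x then f (?g b) else 0)"
    unfolding orbit_term_def by (subst sum.inter_filter) (auto simp: finite_Cyc intro!: sum.cong)
  also have "\<dots> = (\<Sum>k\<in>{0..<int (n div t)}. if ?g (?b k) \<in> stab n x then f (?g (?b k)) else 0)"
    unfolding image sum.reindex[OF inj] by (rule sum.cong[OF refl]) (simp only: comp_apply)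
  \<comment> \<open>The term with the factor \<open>t\<close> does not affect divisibility by
    \<open>t\<close>, so the condition is the same for every \<open>k\<close>.\<close>
  also have "\<dots> = (\<Sum>k\<in>{0..<int (n div t)}. if int t dvd perm_int n x (int s) + int s
      then f (shift_int n ((j + 1) * int t * k - (perm_int n x (int s) + int s))) else 0)"
    unfolding g shift_int_in_stab_iff by (simp add: dvd_diff_right_iff mult.assoc)
  finally show ?thesis .
qed

lemma card_stab: "int (card (stab n x)) = int (n div t)"
proof -
  have "stab n x = (\<lambda>k. shift_int n (int t * k)) ` {0..<int (n div t)}"
  proof (intro equalityI subsetI)
    fix b assume b: "b \<in> stab n x"
    then obtain r where r: "b = shift_int n r" by (auto simp: stab_def Cyc_eq)
    with b obtain k where k: "r = int t * k" by (auto simp: shift_int_in_stab_iff)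
    have "b = shift_int n (int t * (k mod int (n div t)))"
      unfolding r k shift_int_eq_iff cong_mult_t_iff by (simp add: cong_def)
    then show "b \<in> (\<lambda>k. shift_int n (int t * k)) ` {0..<int (n div t)}" using quotient_pos by auto
  qed (auto simp: shift_int_in_stab_iff)
  moreover have "inj_on (\<lambda>k. shift_int n (int t * k)) {0..<int (n div t)}"
  proof (rule inj_onI)
    fix k l assume kl: "k \<in> {0..<int (n div t)}" "l \<in> {0..<int (n div t)}" "shift_int n (int t * k) = shift_int n (int t * l)"
    then have "[k = l] (mod int (n div t))" by (simp add: shift_int_eq_iff cong_mult_t_iff)
    with kl show "k = l" by (simp add: cong_def)
  qed
  ultimately have "card (stab n x) = card {0..<int (n div t)}" by (simp add: card_image)
  then show ?thesis by simp
qed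

lemma fs_indicator_sum:
  assumes "induced_rep n x d \<rho> N \<Phi>" and "group_rep (stab n x) d \<rho>"
  shows "of_nat (n div t) * fs_indicator n (character \<Phi>) =
    (\<Sum>k\<in>{0..<int (n div t)}. if int t dvd perm_int n x (int s) + int s
      then \<Sum>l<d. \<rho> (shift_int n ((j + 1) * int t * k - (perm_int n x (int s) + int s))) $$ (l, l) else 0)"
    (is "_ = ?S")
proof -
  have "of_nat (card (stab n x)) = (of_nat (n div t) :: complex)" using card_stab by simp
  then have "of_nat n * (of_nat (n div t) * fs_indicator n (character \<Phi>)) =
    (\<Sum>c\<in>Cyc n. orbit_term (stab n x) (\<lambda>b. \<Sum>l<d. \<rho> b $$ (l, l)) (ract n x c))"
    using fs_indicator_induced[OF assms x] by (simp add: mult.assoc)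
  also have "\<dots> = (\<Sum>c\<in>Cyc n. ?S)"
    by (intro sum.cong refl) (auto simp: Cyc_eq orbit_term_eq)
  finally show ?thesis using n by (simp add: card_Cyc)
qed

text \<open>The sum over \<open>k\<close> is a geometric series in
  \<open>\<omega> powi (j + 1)\<close>, a root of unity of order dividing \<open>n/t\<close>, so it
  is 0 or \<open>n/t\<close>. Here \<open>e\<close> is the quotient of \<open>x(s) + s\<close> by
  \<open>t\<close>.\<close>

lemma fs_indicator_cases:
  assumes irr: "irreducible_rep (stab n x) d \<rho>" and ind: "induced_rep n x d \<rho> N \<Phi>"
  obtains (zero) "fs_indicator n (character \<Phi>) = 0"
    | (root) \<omega> e where "\<omega> ^ (n div t) = 1" "perm_int n x (int s) + int s = int t * e"
      "\<omega> powi (j + 1) = 1" "fs_indicator n (character \<Phi>) = of_nat d * \<omega> powi (- e)"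
proof -
  let ?m = "n div t" and ?g = "shift n ^^ t"
  have m: "?m > 0" using quotient_pos by simp
  have rep: "group_rep (stab n x) d \<rho>" and d: "d > 0" using irr by (simp_all add: irreducible_rep_def)
  obtain \<omega> where \<omega>: "\<And>k. \<rho> (?g ^^ k) = \<omega> ^ k \<cdot>\<^sub>m 1\<^sub>m d"
    using irreducible_rep_cyclic_scalar[OF irr stab] by metis
  have pow: "?g ^^ k = shift_int n (int t * int k)" for k
    unfolding funpow_mult using shift_pow_eq[of "t * k"] by simp
  have "?g ^^ ?m = id"
    unfolding pow n_eq_mult[symmetric] using shift_int_cong[of "int n" 0] by (simp add: shift_int_0 cong_def)
  then have "\<omega> ^ ?m \<cdot>\<^sub>m 1\<^sub>m d = (1\<^sub>m d :: complex mat)"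
    using \<omega>[of ?m] rep by (simp add: group_rep_def)
  then have "(\<omega> ^ ?m \<cdot>\<^sub>m 1\<^sub>m d) $$ (0, 0) = (1\<^sub>m d :: complex mat) $$ (0, 0)" by simp
  then have \<omega>m: "\<omega> ^ ?m = 1" using d by simp
  then have \<omega>0: "\<omega> \<noteq> 0" using m by (auto simp: power_0_left)
  have tr: "(\<Sum>l<d. \<rho> (shift_int n (int t * i)) $$ (l, l)) = of_nat d * \<omega> powi i" for i
  proof -
    \<comment> \<open>The scalar is known only for natural powers of the generator, so the exponent
      is reduced modulo \<open>n/t\<close>.\<close>
    define k where "k = nat (i mod int ?m)"
    have k: "int k = i mod int ?m" using m by (simp add: k_def)
    have "\<omega> powi i = \<omega> powi (int ?m * (i div int ?m) + int k)" by (simp add: k)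
    also have "\<dots> = \<omega> ^ k"
      using \<omega>0 \<omega>m by (simp add: power_int_add power_int_mult)
    finally have "\<omega> powi i = \<omega> ^ k" .
    moreover have "shift_int n (int t * i) = shift_int n (int t * int k)"
      unfolding shift_int_eq_iff cong_mult_t_iff k by (simp add: cong_def)
    ultimately show ?thesis by (simp add: \<omega> flip: pow)
  qed
  show thesis
  proof (cases "int t dvd perm_int n x (int s) + int s")
    case False
    then have "fs_indicator n (character \<Phi>) = 0"
      using fs_indicator_sum[OF ind rep] m by simp
    then show thesis by (rule zero)
  next
    case True
    then obtain e where e: "perm_int n x (int s) + int s = int t * e" by blast
    let ?z = "\<omega> powi (j + 1)"
    have "of_nat ?m * fs_indicator n (character \<Phi>)
        = (\<Sum>k\<in>{0..<int ?m}. of_nat d * \<omega> powi ((j + 1) * k - e))"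
      unfolding fs_indicator_sum[OF ind rep] e
      by (simp add: mult.assoc mult.left_commute[of _ "int t"] flip: tr right_diff_distrib)
    also have "\<dots> = (\<Sum>k\<in>int ` {0..<?m}. of_nat d * \<omega> powi (- e) * ?z powi k)"
    proof -
      have "\<omega> powi ((j + 1) * k - e) = \<omega> powi (- e) * ?z powi k" for k
        using power_int_add[of \<omega> "- e" "(j + 1) * k"] \<omega>0 by (simp add: power_int_mult)
      then show ?thesis by (simp add: image_int_atLeastLessThan mult.assoc)
    qed
    also have "\<dots> = of_nat d * \<omega> powi (- e) * (\<Sum>k<?m. ?z ^ k)"
      by (simp add: sum.reindex sum_distrib_left lessThan_atLeast0)
    finally have fs: "of_nat ?m * fs_indicator n (character \<Phi>)
        = of_nat d * \<omega> powi (- e) * (\<Sum>k<?m. ?z ^ k)" .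
    show thesis
    proof (cases "?z = 1")
      case True
      with fs m have "fs_indicator n (character \<Phi>) = of_nat d * \<omega> powi (- e)" by simp
      with \<omega>m e True show thesis by (rule root)
    next
      case False
      have "?z ^ ?m = (\<omega> ^ ?m) powi (j + 1)"
        by (metis power_int_mult power_int_of_nat mult.commute)
      then have "(\<Sum>k<?m. ?z ^ k) = 0"
        using \<omega>m False by (simp add: geometric_sum)
      with fs m have "fs_indicator n (character \<Phi>) = 0" by simp
      then show thesis by (rule zero)
    qed
  qed
qed

section \<open>Nonnegativity criteria\<close>

text \<open>By \<open>inv_ract\<close>, the hypothesis on \<open>u\<close> says that inversion fixes
  \<open>x \<lhd> a^u\<close>. Applying \<open>x\<close> to \<open>s + x(u) = u + tk\<close> gives
  \<open>u + x(s) = x(u) + jtk\<close>, hence \<open>te = (j + 1)tk\<close> modulo \<open>n\<close>.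
  So \<open>\<omega> powi e = 1\<close> and the indicator is \<open>d\<close>.\<close>

lemma fs_indicator_nonneg_if_fixpoint:
  assumes irr: "irreducible_rep (stab n x) d \<rho>" and ind: "induced_rep n x d \<rho> N \<Phi>"
    and u: "int t dvd int s + perm_int n x u - u"
  shows "fs_indicator n (character \<Phi>) \<ge> 0"
  using irr ind
proof (cases rule: fs_indicator_cases)
  case (root \<omega> e)
  let ?m = "int (n div t)"
  obtain k where k: "int s + perm_int n x u - u = int t * k" using u by blast
  have "[perm_int n x (int s + perm_int n x u) = perm_int n x u + j * int t * k] (mod int n)"
    using perm_int_periodic[of u k] k by (simp add: algebra_simps)
  then have "[u + perm_int n x (int s) = perm_int n x u + j * int t * k] (mod int n)"
    by (rule cong_trans[OF cong_sym[OF perm_int_perm_int]])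
  then have "[u + perm_int n x (int s) + (int s - u)
      = perm_int n x u + j * int t * k + (int s - u)] (mod int n)"
    by (rule cong_add[OF _ cong_refl])
  moreover have "u + perm_int n x (int s) + (int s - u) = int t * e" using root(2) by simp
  moreover have "perm_int n x u + j * int t * k + (int s - u) = int t * ((j + 1) * k)"
    using k by (simp add: algebra_simps)
  ultimately have "[e = (j + 1) * k] (mod ?m)" by (simp only: cong_mult_t_iff)
  then obtain q where q: "(j + 1) * k = e + ?m * q" by (auto simp: cong_iff_lin)
  have "\<omega> \<noteq> 0" using root(1) quotient_pos by (auto simp: power_0_left)
  have "\<omega> powi (e + ?m * q) = 1"
    using root(3) by (simp add: power_int_mult flip: q)
  then have "\<omega> powi e = 1"
    using \<open>\<omega> \<noteq> 0\<close> root(1) by (simp add: power_int_add power_int_mult)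
  with root(4) show ?thesis by (simp add: power_int_minus less_eq_complex_def)
qed simp

lemma fs_indicator_nonneg_if_odd_index:
  assumes irr: "irreducible_rep (stab n x) d \<rho>" and ind: "induced_rep n x d \<rho> N \<Phi>"
    and "odd t"
  shows "fs_indicator n (character \<Phi>) \<ge> 0"
  using irr ind
proof (cases rule: fs_indicator_cases)
  case (root \<omega> e)
  text \<open>\<open>u \<mapsto> s + x(u)\<close> is an involution of the residues modulo \<open>t\<close>, which describes
    inversion on the orbit of \<open>x\<close>.\<close>
  let ?f = "\<lambda>u. (int s + perm_int n x u) mod int t"
  have "?f (?f u) = u" if u: "u \<in> {0..<int t}" for u
  proof -
    \<comment> \<open>The remainder is written as a shift by a multiple of \<open>t\<close>, so that
      periodicity shows it has no effect modulo \<open>t\<close>.\<close>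
    have "?f u = int s + perm_int n x u + int t * (- ((int s + perm_int n x u) div int t))"
      by (simp add: minus_div_mult_eq_mod[symmetric] mult.commute)
    then have "[perm_int n x (?f u) = perm_int n x (int s + perm_int n x u)
        + j * int t * (- ((int s + perm_int n x u) div int t))] (mod int n)"
      using perm_int_periodic[of "int s + perm_int n x u" "- ((int s + perm_int n x u) div int t)"] by simp
    then have "[perm_int n x (?f u) = perm_int n x (int s + perm_int n x u)
        + j * int t * (- ((int s + perm_int n x u) div int t))] (mod int t)"
      by (rule cong_dvd_modulus) (use t in simp)
    then have "[perm_int n x (?f u) = perm_int n x (int s + perm_int n x u)] (mod int t)"
      by (rule cong_trans) (simp add: cong_iff_dvd_diff)
    moreover have "[perm_int n x (int s + perm_int n x u) = u + perm_int n x (int s)] (mod int t)"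
      using perm_int_perm_int by (rule cong_dvd_modulus) (use t in simp)
    ultimately have "[int s + perm_int n x (?f u) = int s + (u + perm_int n x (int s))] (mod int t)"
      by (intro cong_add[OF cong_refl]) (rule cong_trans)
    \<comment> \<open>Here the divisibility of \<open>x(s) + s\<close> by \<open>t\<close> makes
      \<open>?f\<close> an involution.\<close>
    moreover have "int s + (u + perm_int n x (int s)) = u + int t * e" using root(2) by simp
    ultimately show ?thesis using u by (simp add: cong_def)
  qed
  moreover have "?f ` {0..<int t} \<subseteq> {0..<int t}" using t by auto
  ultimately obtain u where "?f u = u"
    using involution_fixpoint[of "{0..<int t}" ?f] \<open>odd t\<close> by auto
  then have "int t dvd int s + perm_int n x u - u" by (metis dvd_minus_mod)
  from fs_indicator_nonneg_if_fixpoint[OF irr ind this] show ?thesis .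
qed simp

text \<open>\<open>x\<close> fixes \<open>te = s + x(s)\<close> and also sends it to
  \<open>jte\<close>, so \<open>\<omega> powi (j * e) = \<omega> powi e\<close>. With
  \<open>\<omega> powi (j + 1) = 1\<close> the square of \<open>\<omega> powi e\<close> is 1, and so
  is its odd power with exponent \<open>n/t\<close>; hence it is 1.\<close>

lemma fs_indicator_nonneg_if_odd_stab:
  assumes irr: "irreducible_rep (stab n x) d \<rho>" and ind: "induced_rep n x d \<rho> N \<Phi>"
    and odd: "odd (n div t)"
  shows "fs_indicator n (character \<Phi>) \<ge> 0"
  using irr ind
proof (cases rule: fs_indicator_cases)
  case (root \<omega> e)
  have \<omega>0: "\<omega> \<noteq> 0" using root(1) quotient_pos by (auto simp: power_0_left)
  have "[perm_int n x (int t * e) = int t * e] (mod int n)"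
    using perm_int_perm_int[of "int s"] root(2) by (simp add: add.commute)
  then have "[j * int t * e = int t * e] (mod int n)"
    by (rule cong_trans[OF cong_sym[OF perm_int_multiple]])
  moreover have "j * int t * e = int t * (j * e)" by simp
  ultimately have "[int t * (j * e) = int t * e] (mod int n)" by (simp only:)
  then have "[j * e = e] (mod int (n div t))" by (simp only: cong_mult_t_iff)
  then obtain q where q: "e = j * e + int (n div t) * q" by (auto simp: cong_iff_lin)
  have "\<omega> powi (j * e + int (n div t) * q) = \<omega> powi (j * e) * (\<omega> powi int (n div t)) powi q"
    using \<omega>0 by (simp only: power_int_add power_int_mult disj_not1 simp_thms)
  then have "\<omega> powi e = \<omega> powi (j * e)" using root(1) by (simp flip: q)
  moreover have "\<omega> powi (j * e) * \<omega> powi e = 1"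
    using power_int_add[of \<omega> "j * e" e] power_int_mult[of \<omega> "j + 1" e] root(3) \<omega>0
    by (simp add: distrib_right)
  ultimately have sq: "(\<omega> powi e) ^ 2 = 1" by (simp add: power2_eq_square)
  have "(\<omega> powi e) ^ (n div t) = (\<omega> ^ (n div t)) powi e"
    by (metis power_int_mult power_int_of_nat mult.commute)
  then have one: "(\<omega> powi e) ^ (n div t) = 1" using root(1) by simp
  obtain r where "n div t = 2 * r + 1" using odd by (rule oddE)
  with one sq have "\<omega> powi e = 1" by (simp add: power_add power_mult)
  with root(4) show ?thesis by (simp add: power_int_minus less_eq_complex_def)
qed simp

text \<open>Such a \<open>y\<close> is its own inverse, which is the fixed point that
  \<open>fs_indicator_nonneg_if_fixpoint\<close> asks for.\<close>

lemma fs_indicator_nonneg_if_involution: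
  assumes irr: "irreducible_rep (stab n x) d \<rho>" and ind: "induced_rep n x d \<rho> N \<Phi>"
    and y: "y \<in> orb n x" "y \<circ> y = id"
  shows "fs_indicator n (character \<Phi>) \<ge> 0"
proof -
  obtain u where u: "y = ract n x (shift_int n u)" using y by (auto simp: orb_def Cyc_eq)
  have "Hilbert_Choice.inv y = y" using y(2) by (intro inv_unique_comp)
  then have "int t dvd int s + perm_int n x u - u"
    unfolding u inv_ract ract_shift_int_eq_iff .
  with irr ind show ?thesis by (rule fs_indicator_nonneg_if_fixpoint)
qed

end

end

theorem proposition4p3p5:
  fixes n t s :: nat and j :: int and x :: perm
  assumes "n \<ge> 2" and "x \<in> Stab0 n"
    and "t > 0" and "t dvd n" and "stab n x = {(shift n ^^ t) ^^ k | k. True}"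
    and "[int (x (t mod n)) = j * int t] (mod int n)" and "coprime j (int (n div t))"
  shows "(\<forall>y\<in>orb n x. stab n y = stab n x \<and>
      (\<forall>d \<rho> \<chi>x \<chi>y. irreducible_rep (stab n x) d \<rho> \<longrightarrow>
        induced_character n x d \<rho> \<chi>x \<longrightarrow> induced_character n y d \<rho> \<chi>y \<longrightarrow>
        fs_indicator n \<chi>x = fs_indicator n \<chi>y))
    \<and> (Hilbert_Choice.inv x = ract n x (shift n ^^ s) \<longrightarrow>
      (\<forall>d \<rho> \<chi>. irreducible_rep (stab n x) d \<rho> \<longrightarrow> induced_character n x d \<rho> \<chi> \<longrightarrow>
        ((\<exists>y\<in>orb n x. y \<noteq> id \<and> y \<circ> y = id) \<longrightarrow> fs_indicator n \<chi> \<ge> 0) \<and>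
        (odd t \<longrightarrow> fs_indicator n \<chi> \<ge> 0) \<and>
        (\<forall>m. n = 2 * m \<and> odd m \<longrightarrow> fs_indicator n \<chi> \<ge> 0)))"
proof (intro conjI ballI impI allI)
  have n: "n > 0" using assms(1) by simp
  fix y assume y: "y \<in> orb n x"
  then show "stab n y = stab n x"
    using stab_ract[OF n assms(2)] by (auto simp: orb_def)
  fix d \<rho> \<chi>x \<chi>y
  assume "irreducible_rep (stab n x) d \<rho>" "induced_character n x d \<rho> \<chi>x"
    "induced_character n y d \<rho> \<chi>y"
  then show "fs_indicator n \<chi>x = fs_indicator n \<chi>y"
    using fs_indicator_orbit[OF n assms(2) y]
    by (auto simp: induced_character_def irreducible_rep_def)
next
  have n: "n > 0" using assms(1) by simp
  fix d \<rho> \<chi>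
  assume inv: "Hilbert_Choice.inv x = ract n x (shift n ^^ s)"
    and irr: "irreducible_rep (stab n x) d \<rho>" and "induced_character n x d \<rho> \<chi>"
  then obtain N \<Phi> where ind: "induced_rep n x d \<rho> N \<Phi>" and \<chi>: "\<chi> = character \<Phi>"
    by (auto simp: induced_character_def)
  note hyps = n assms(2-6) inv irr ind
  {
    assume "\<exists>y\<in>orb n x. y \<noteq> id \<and> y \<circ> y = id"
    then show "fs_indicator n \<chi> \<ge> 0"
      unfolding \<chi> using fs_indicator_nonneg_if_involution[OF hyps] by blast
  }
  show odd_t: "fs_indicator n \<chi> \<ge> 0" if "odd t"
    unfolding \<chi> using that by (rule fs_indicator_nonneg_if_odd_index[OF hyps])
  fix m assume m: "n = 2 * m \<and> odd m"
  show "fs_indicator n \<chi> \<ge> 0"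
  proof (cases "odd t")
    \<comment> \<open>An even \<open>t\<close> contains the only factor 2 of \<open>n\<close>, so
      \<open>n/t\<close> divides the odd \<open>m\<close>.\<close>
    case False
    then obtain r where r: "t = 2 * r" by (auto elim: evenE)
    obtain q where q: "n = t * q" using assms(4) by blast
    then have "m = r * q" using m r by simp
    then have "odd (n div t)" using m q assms(3) by simp
    then show ?thesis
      unfolding \<chi> by (rule fs_indicator_nonneg_if_odd_stab[OF hyps])
  qed (rule odd_t)
qed

end
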